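(* Let $n=2$, let $\mathbf A\in L(\mathbb R^2)$ be an orthogonal operator with $\mathbf A^m=\mathbf I$ for some positive integer $m$, and let $X(t)$, $X^*(t)$, $t\ge0$, be the solutions of $D_HX(t)=\mathbf AX(t)$ with initial conditions $X(0)=X_0\in\mathfrak C$, $X^*(0)=X_0^*\in\mathfrak C$. Then, for all $t\ge0$: if $m\ge3$ is odd, $$\begin{aligned}S[X(t),X^*(t)]={}&\frac1m\Big(e^{2t}+2\sum_{q=1}^{[m/2]}e^{2t\cos\frac{2\pi q}{m}}\Big)S[X_0,X_0^*]\\&+\frac1{m^2}\sum_{p=1}^{m-1}\Big((m-p)e^{2t}+2\sum_{q=1}^{[m/2]}\Big[(m-p)\cos\frac{2\pi pq}{m}+2t\sin\frac{2\pi pq}{m}\sin\frac{2\pi q}{m}\Big]e^{2t\cos\frac{2\pi q}{m}}\Big)\\&\qquad\times\big(S[X_0,\mathbf A^pX_0^*]+S[X_0^*,\mathbf A^pX_0]\big);\end{aligned}$$ if $m\ge4$ is even, $$\begin{aligned}S[X(t),X^*(t)]={}&\frac1m\Big(e^{2t}+e^{-2t}+2\sum_{q=1}^{(m-2)/2}e^{2t\cos\frac{2\pi q}{m}}\Big)S[X_0,X_0^*]\\&+\frac1{m^2}\sum_{p=1}^{m-1}\Big((m-p)\big(e^{2t}+(-1)^pe^{-2t}\big)+2\sum_{q=1}^{(m-2)/2}\Big[(m-p)\cos\frac{2\pi pq}{m}+2t\sin\frac{2\pi pq}{m}\sin\frac{2\pi q}{m}\Big]e^{2t\cos\frac{2\pi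 q}{m}}\Big)\\&\qquad\times\big(S[X_0,\mathbf A^pX_0^*]+S[X_0^*,\mathbf A^pX_0]\big).\end{aligned}$$
   Context: $\operatorname{conv}\mathbb R^2$ is the space of nonempty convex compact subsets of $\mathbb R^2$ with the Hausdorff metric $d_H$. $\mathfrak C=\{X\in\operatorname{conv}\mathbb R^2:\operatorname{int}X\neq\emptyset\}$. $\mathbf AX=\{\mathbf Ax:x\in X\}$; sums of sets are Minkowski sums. $S[X,Y]$ is the Minkowski mixed area of $X,Y\in\operatorname{conv}\mathbb R^2$, normalized so that $S[X,X]$ is the area of $X$. $[m/2]$ denotes the integer part. Hukuhara derivative: for $X,Y\in\operatorname{conv}\mathbb R^2$, the Hukuhara difference $X\ominus Y$ is the set $Z\in\operatorname{conv}\mathbb R^2$ with $X=Y+Z$, if it exists. $D_HX(t)$ is the element of $\operatorname{conv}\mathbb R^2$ that is the common $d_H$-limit, as $h\to0^+$, of $h^{-1}(X(t+h)\ominus X(t))$ and $h^{-1}(X(t)\ominus X(t-h))$ (only the first at $t=0$). The Cauchy problem $D_HX=\mathbf AX$, $X(0)=X_0$, has a unique solution on $[0,\infty)$, equivalently $X(t)=X_0+\int_0^t\mathbf AX(s)\,ds$ (set-valued integral). *)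

theory Defs
  imports "HOL-Analysis.Analysis" "HOL-Library.Set_Algebras"
begin

text \<open>Sums of sets are Minkowski sums, i.e. the instance \<open>set :: (plus) plus\<close> of
  \<open>HOL-Library.Set_Algebras\<close>.\<close>

definition convex_bodies :: "'a::euclidean_space set set" where
  "convex_bodies = {X. X \<noteq> {} \<and> convex X \<and> compact X}"

definition solid_convex_bodies :: "'a::euclidean_space set set" where
  "solid_convex_bodies = {X \<in> convex_bodies. interior X \<noteq> {}}"

text \<open>Meaningful on nonempty compact sets only: elsewhere the suprema may be unspecified.\<close>

definition hausdorff_dist :: "'a::metric_space set \<Rightarrow> 'a set \<Rightarrow> real" where
  "hausdorff_dist X Y = max (SUP x\<in>X. infdist x Y) (SUP y\<in>Y. infdist y X)"

definition is_hukuhara_diff ::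
    "'a::euclidean_space set \<Rightarrow> 'a set \<Rightarrow> 'a set \<Rightarrow> bool" where
  "is_hukuhara_diff X Y Z \<longleftrightarrow> Z \<in> convex_bodies \<and> X = Y + Z"

definition hukuhara_diff_exists :: "'a::euclidean_space set \<Rightarrow> 'a set \<Rightarrow> bool" where
  "hukuhara_diff_exists X Y \<longleftrightarrow> (\<exists>Z. is_hukuhara_diff X Y Z)"

definition hukuhara_diff :: "'a::euclidean_space set \<Rightarrow> 'a set \<Rightarrow> 'a set" where
  "hukuhara_diff X Y = (THE Z. is_hukuhara_diff X Y Z)"

lemma is_hukuhara_diff_unique:
  fixes X Y Z Z' :: "'a::euclidean_space set"
  assumes "Y \<in> convex_bodies" "is_hukuhara_diff X Y Z" "is_hukuhara_diff X Y Z'"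
  shows "Z = Z'"
proof -
  have sub: "U \<subseteq> V" if eq: "Y + U = Y + V" and V: "V \<in> convex_bodies" for U V :: "'a set"
  proof
    fix z assume z: "z \<in> U"
    show "z \<in> V"
    proof (rule ccontr)
      assume "z \<notin> V"
      moreover have "convex V" "closed V"
        using V by (auto simp: convex_bodies_def compact_imp_closed)
      ultimately obtain a b where ab: "inner a z < b" "\<And>x. x \<in> V \<Longrightarrow> b < inner a x"
        using separating_hyperplane_closed_point[of V z] by blast
      have "compact Y" "Y \<noteq> {}" using assms(1) by (auto simp: convex_bodies_def)
      moreover have "continuous_on Y (inner a)" by (intro continuous_intros)
      ultimately obtain y where y: "y \<in> Y" "\<And>x. x \<in> Y \<Longrightarrow> inner a y \<le> inner a x"
        using continuous_attains_inf[of Y "inner a"] by blast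
      have "y + z \<in> Y + V" using set_plus_intro[OF y(1) z] eq by simp
      then obtain y' v where v: "y' \<in> Y" "v \<in> V" "y + z = y' + v"
        by (auto elim: set_plus_elim)
      then have "inner a y + inner a z = inner a y' + inner a v"
        by (metis inner_add_right)
      with ab(1) ab(2)[OF v(2)] y(2)[OF v(1)] show False by linarith
    qed
  qed
  have Z: "Y + Z = Y + Z'" "Z \<in> convex_bodies" "Z' \<in> convex_bodies"
    using assms(2,3) unfolding is_hukuhara_diff_def by metis+
  show ?thesis
    by (rule equalityI[OF sub[OF Z(1) Z(3)] sub[OF Z(1)[symmetric] Z(2)]])
qed

lemma hukuhara_diff_eqI:
  assumes "Y \<in> convex_bodies" "is_hukuhara_diff X Y Z"
  shows "hukuhara_diff X Y = Z"
  unfolding hukuhara_diff_def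
  using assms is_hukuhara_diff_unique by (intro the_equality) blast+

text \<open>\<open>D\<close> is the Hukuhara derivative at \<open>t \<ge> 0\<close> of a map defined on \<open>[0, \<infinity>)\<close>.  The
  differences are required to exist for all sufficiently small \<open>h > 0\<close>; at \<open>t = 0\<close> only
  the forward quotient is considered.\<close>

definition has_hukuhara_derivative ::
    "(real \<Rightarrow> 'a::euclidean_space set) \<Rightarrow> 'a set \<Rightarrow> real \<Rightarrow> bool" where
  "has_hukuhara_derivative X D t \<longleftrightarrow>
     D \<in> convex_bodies \<and>
     (\<forall>\<^sub>F h in at_right 0. hukuhara_diff_exists (X (t + h)) (X t)) \<and>
     ((\<lambda>h. hausdorff_dist ((*\<^sub>R) (inverse h) ` hukuhara_diff (X (t + h)) (X t)) D)
        \<longlongrightarrow> 0) (at_right 0) \<and>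
     (t > 0 \<longrightarrow>
        (\<forall>\<^sub>F h in at_right 0. hukuhara_diff_exists (X t) (X (t - h))) \<and>
        ((\<lambda>h. hausdorff_dist ((*\<^sub>R) (inverse h) ` hukuhara_diff (X t) (X (t - h))) D)
           \<longlongrightarrow> 0) (at_right 0))"

text \<open>Solutions on \<open>[0, \<infinity>)\<close> of \<open>D\<^sub>H X = A X\<close>, \<open>X(0) = X\<^sub>0\<close>; the values of \<open>X\<close> at
  negative times are irrelevant.\<close>

definition is_hukuhara_solution ::
    "('a::euclidean_space \<Rightarrow> 'a) \<Rightarrow> 'a set \<Rightarrow> (real \<Rightarrow> 'a set) \<Rightarrow> bool" where
  "is_hukuhara_solution A X0 X \<longleftrightarrow>
     X 0 = X0 \<and>
     (\<forall>t\<ge>0. X t \<in> convex_bodies \<and> has_hukuhara_derivative X (A ` X t) t)"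

text \<open>Minkowski mixed area: half the mixed term of
  \<open>area (X + Y) = S[X,X] + 2 S[X,Y] + S[Y,Y]\<close>.\<close>

definition mixed_area :: "(real^2) set \<Rightarrow> (real^2) set \<Rightarrow> real" where
  "mixed_area X Y =
     (measure lebesgue (X + Y) - measure lebesgue X - measure lebesgue Y) / 2"

lemma mixed_area_self:
  assumes "X \<in> convex_bodies"
  shows "mixed_area X X = measure lebesgue X"
proof -
  have "convex X" using assms by (simp add: convex_bodies_def)
  have "X + X = (*\<^sub>R) 2 ` X"
  proof (intro equalityI subsetI)
    fix z assume "z \<in> X + X"
    then obtain x y where xy: "x \<in> X" "y \<in> X" "z = x + y" by (auto elim: set_plus_elim)
    then have "(1/2) *\<^sub>R x + (1/2) *\<^sub>R y \<in> X"
      using \<open>convex X\<close> by (intro convexD) auto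
    moreover have "z = 2 *\<^sub>R ((1/2) *\<^sub>R x + (1/2) *\<^sub>R y)"
      using xy by (simp add: algebra_simps)
    ultimately show "z \<in> (*\<^sub>R) 2 ` X" by blast
  next
    fix z assume "z \<in> (*\<^sub>R) 2 ` X"
    then obtain x where "x \<in> X" "z = x + x" by (metis imageE scaleR_2)
    then show "z \<in> X + X" by (simp only: set_plus_intro)
  qed
  moreover have "measure lebesgue ((*\<^sub>R) 2 ` X) = 4 * measure lebesgue X"
    using measure_lebesgue_affine[of 2 0 X] by simp
  ultimately show ?thesis by (simp add: mixed_area_def)
qed

end

theory Submission
  imports Defs
begin

text \<open>
  For polytopes \<open>P\<^sub>i\<close> with vertex set \<open>F\<^sub>i\<close> the gradient of \<open>\<phi>\<^sub>i x = ln (\<Sum>v\<in>F\<^sub>i. exp (v \<bullet> x))\<close> maps the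
  plane diffeomorphically onto the interior of \<open>P\<^sub>i\<close>, and gradients add up to such a map for Minkowski
  sums. Hence the area of \<open>\<Sum>i. a\<^sub>i P\<^sub>i\<close> is the integral of the determinant of \<open>\<Sum>i. a\<^sub>i D\<^sup>2\<phi>\<^sub>i\<close>, a
  quadratic form in \<open>a\<close>; approximation from inside extends this to convex bodies, so that the mixed
  area is bilinear.

  Applied to support functions, the equation \<open>D\<^sub>H X = A X\<close> becomes the cyclic linear system
  \<open>y\<^sub>p' = y\<^bsub>p+1\<^esub>\<close> for \<open>p\<close> modulo \<open>m\<close>, so \<open>X t = \<Sum>p<m. c\<^sub>p(t) A\<^sup>p X\<^sub>0\<close> where \<open>c\<^sub>p(t)\<close> is the sum of
  \<open>t\<^sup>k / k!\<close> over \<open>k \<equiv> p (mod m)\<close>. Since \<open>A\<close> preserves area, the mixed area of two solutions is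
  \<open>\<Sum>r<m. d\<^sub>r(t) S[X\<^sub>0, A\<^sup>r X\<^sub>0\<^sup>*]\<close> with the cyclic autocorrelation \<open>d\<^sub>r\<close> of \<open>c\<close>, which the discrete Fourier
  transform evaluates as \<open>d\<^sub>r(t) = (1/m) \<Sum>q<m. exp (2 t cos (2\<pi>q/m)) cos (2\<pi>qr/m)\<close>.
\<close>

subsection \<open>Gradient charts of convex bodies\<close>

text \<open>\<open>\<phi>\<close> is a strictly convex potential with gradient \<open>G\<close> and Hessian \<open>D\<close> that dominates the
  support function of \<open>K\<close> up to a constant. This makes \<open>G\<close> a bijection of the plane onto \<open>K\<close> up to
  a null set.\<close>

definition gradient_chart ::
    "(real^2) set \<Rightarrow> (real^2 \<Rightarrow> real) \<Rightarrow> (real^2 \<Rightarrow> real^2) \<Rightarrow> (real^2 \<Rightarrow> real^2 \<Rightarrow> real^2) \<Rightarrow> bool" where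
  "gradient_chart K \<phi> G D \<longleftrightarrow>
     (\<forall>x. (\<phi> has_derivative (\<bullet>) (G x)) (at x)) \<and>
     (\<forall>x. (G has_derivative D x) (at x)) \<and>
     (\<forall>x h. 0 \<le> D x h \<bullet> h) \<and>
     (\<forall>x y. x \<noteq> y \<longrightarrow> 0 < (G x - G y) \<bullet> (x - y)) \<and>
     (\<forall>x. G x \<in> K) \<and>
     (\<exists>C. \<forall>x. \<forall>p\<in>K. p \<bullet> x \<le> \<phi> x + C)"

lemma gradient_chart_add:
  assumes "gradient_chart K \<phi> G D" "gradient_chart K' \<phi>' G' D'"
  shows "gradient_chart (K + K') (\<lambda>x. \<phi> x + \<phi>' x) (\<lambda>x. G x + G' x) (\<lambda>x h. D x h + D' x h)"
proof -
  obtain C C' where C: "\<And>x p. p \<in> K \<Longrightarrow> p \<bullet> x \<le> \<phi> x + C" "\<And>x p. p \<in> K' \<Longrightarrow> p \<bullet> x \<le> \<phi>' x + C'"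
    using assms unfolding gradient_chart_def by metis
  have "p \<bullet> x \<le> \<phi> x + \<phi>' x + (C + C')" if p: "p \<in> K + K'" for p x
  proof -
    obtain a b where ab: "a \<in> K" "b \<in> K'" "p = a + b" using p by (auto elim: set_plus_elim)
    then show ?thesis using C(1)[OF ab(1), of x] C(2)[OF ab(2), of x] by (simp add: inner_add_left)
  qed
  then have "\<exists>C. \<forall>x. \<forall>p\<in>K + K'. p \<bullet> x \<le> \<phi> x + \<phi>' x + C" by blast
  moreover have "0 < (G x + G' x - (G y + G' y)) \<bullet> (x - y)" if "x \<noteq> y" for x y
  proof -
    have "0 < (G x - G y) \<bullet> (x - y)" "0 < (G' x - G' y) \<bullet> (x - y)"
      using assms that unfolding gradient_chart_def by blast+
    then show ?thesis by (simp add: inner_simps)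
  qed
  moreover have "((\<lambda>x. \<phi> x + \<phi>' x) has_derivative (\<bullet>) (G x + G' x)) (at x)" for x
  proof -
    have "(\<phi> has_derivative (\<bullet>) (G x)) (at x)" "(\<phi>' has_derivative (\<bullet>) (G' x)) (at x)"
      using assms unfolding gradient_chart_def by blast+
    from has_derivative_add[OF this] show ?thesis by (simp flip: inner_add_left)
  qed
  ultimately show ?thesis
    using assms unfolding gradient_chart_def
    by (simp add: inner_add_left[of "D _ _"] has_derivative_add set_plus_intro)
qed

lemma gradient_chart_scale:
  assumes "gradient_chart K \<phi> G D" "c > 0"
  shows "gradient_chart ((*\<^sub>R) c ` K) (\<lambda>x. c * \<phi> x) (\<lambda>x. c *\<^sub>R G x) (\<lambda>x h. c *\<^sub>R D x h)"
proof -
  obtain C where C: "\<And>x p. p \<in> K \<Longrightarrow> p \<bullet> x \<le> \<phi> x + C"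
    using assms unfolding gradient_chart_def by metis
  have "p \<bullet> x \<le> c * \<phi> x + c * C" if p: "p \<in> (*\<^sub>R) c ` K" for p x
  proof -
    obtain a where a: "a \<in> K" "p = c *\<^sub>R a" using p by auto
    then show ?thesis using C[OF a(1), of x] \<open>c > 0\<close> by (simp flip: distrib_left)
  qed
  then have "\<exists>C. \<forall>x. \<forall>p\<in>(*\<^sub>R) c ` K. p \<bullet> x \<le> c * \<phi> x + C" by blast
  moreover have "0 < (c *\<^sub>R G x - c *\<^sub>R G y) \<bullet> (x - y)" if "x \<noteq> y" for x y
  proof -
    have "0 < (G x - G y) \<bullet> (x - y)"
      using assms that unfolding gradient_chart_def by blast+
    then show ?thesis using \<open>c > 0\<close> by (simp flip: scaleR_diff_right)
  qed
  moreover have "((\<lambda>x. c * \<phi> x) has_derivative (\<bullet>) (c *\<^sub>R G x)) (at x)" for x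
  proof -
    have "(\<phi> has_derivative (\<bullet>) (G x)) (at x)" using assms unfolding gradient_chart_def by blast
    from has_derivative_mult_right[OF this] show ?thesis by (simp flip: inner_scaleR_left)
  qed
  ultimately show ?thesis
    using assms unfolding gradient_chart_def
    by (simp add: has_derivative_scaleR_right)
qed

lemma det_nonneg_2:
  fixes f :: "real^2 \<Rightarrow> real^2"
  assumes "linear f" and nonneg: "\<And>h. 0 \<le> f h \<bullet> h"
  shows "0 \<le> det (matrix f)"
proof -
  define a b c d where abcd: "a = f (axis 1 1) $ 1" "b = f (axis 2 1) $ 1"
    "c = f (axis 1 1) $ 2" "d = f (axis 2 1) $ 2"
  have q: "0 \<le> a * x\<^sup>2 + (b + c) * x * y + d * y\<^sup>2" for x y
  proof -
    have "f (x *\<^sub>R axis 1 1 + y *\<^sub>R axis 2 1) = x *\<^sub>R f (axis 1 1) + y *\<^sub>R f (axis 2 1)"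
      by (simp add: linear_add[OF assms(1)] linear_scale[OF assms(1)])
    then show ?thesis
      using nonneg[of "x *\<^sub>R axis 1 1 + y *\<^sub>R axis 2 1"]
      by (simp add: inner_vec_def sum_2 axis_def abcd power2_eq_square algebra_simps)
  qed
  have "(b + c)\<^sup>2 \<le> 4 * a * d"
  proof (cases "a = 0")
    case True
    have "b + c = 0"
    proof (rule ccontr)
      assume "b + c \<noteq> 0"
      then have "(b + c) * (- (d + 1) / (b + c)) = - (d + 1)" by simp
      then show False
        using q[of "- (d + 1) / (b + c)" 1] True by simp
    qed
    then show ?thesis using True by simp
  next
    case False
    then have "a > 0" using q[of 1 0] by simp
    have "0 \<le> a * (b + c)\<^sup>2 + (b + c) * (b + c) * (- 2 * a) + d * (- 2 * a)\<^sup>2"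
      by (rule q)
    also have "\<dots> = a * (4 * a * d - (b + c)\<^sup>2)" by (simp add: power2_eq_square algebra_simps)
    finally show ?thesis using \<open>a > 0\<close> by (simp add: zero_le_mult_iff)
  qed
  then have "4 * (a * d - b * c) \<ge> (b - c)\<^sup>2"
    by (simp add: power2_eq_square algebra_simps)
  from order_trans[OF zero_le_power2 this] have "a * d - b * c \<ge> 0" by simp
  then show ?thesis by (simp add: det_2 matrix_def abcd)
qed

lemma interior_subset_range_gradient:
  assumes "gradient_chart K \<phi> G D"
  shows "interior K \<subseteq> range G"
proof
  fix p assume "p \<in> interior K"
  then obtain r where r: "r > 0" "cball p r \<subseteq> K"
    by (meson interior_subset mem_interior_cball)
  obtain C where C: "\<And>x p. p \<in> K \<Longrightarrow> p \<bullet> x \<le> \<phi> x + C"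
    using assms unfolding gradient_chart_def by metis
  \<comment> \<open>\<open>p\<close> is the gradient of \<open>\<phi>\<close> at a minimum of the coercive function \<open>\<phi> - p \<bullet> _\<close>.\<close>
  define f where "f = (\<lambda>x. \<phi> x - p \<bullet> x)"
  have coercive: "r * norm x - C \<le> f x" for x
  proof (cases "x = 0")
    case True
    have "p \<in> K" using r by auto
    then show ?thesis using C[of p 0] True by (simp add: f_def)
  next
    case False
    have "p + (r / norm x) *\<^sub>R x \<in> K" using r by (intro subsetD[OF r(2)]) (auto simp: dist_norm False)
    from C[OF this, of x] show ?thesis
      using False by (simp add: f_def inner_add_left power2_norm_eq_inner[symmetric] power2_eq_square)
  qed
  have der: "(f has_derivative (\<lambda>h. G x \<bullet> h - p \<bullet> h)) (at x)" for x
    using assms unfolding f_def gradient_chart_def by (auto intro!: derivative_intros)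
  define R where "R = (f 0 + C + 1) / r"
  have "R \<ge> 0" using coercive[of 0] r by (simp add: R_def)
  have "continuous_on (cball 0 R) f"
    using der has_derivative_continuous by (blast intro: continuous_at_imp_continuous_on)
  then obtain x where x: "x \<in> cball 0 R" "\<And>y. y \<in> cball 0 R \<Longrightarrow> f x \<le> f y"
    using continuous_attains_inf[of "cball 0 R" f] \<open>R \<ge> 0\<close> by auto
  have min: "f x \<le> f y" for y
  proof (cases "y \<in> cball 0 R")
    case False
    then have "norm y > R" by simp
    then have "r * norm y > f 0 + C + 1" using r by (simp add: R_def field_simps)
    then have "f y > f 0" using coercive[of y] by linarith
    then show ?thesis using x(2)[of 0] \<open>R \<ge> 0\<close> by simp
  qed (use x in blast)
  have "(\<lambda>h. G x \<bullet> h - p \<bullet> h) = (\<lambda>h. 0)"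
    by (rule has_derivative_local_min[OF der]) (simp add: min)
  then have "(G x - p) \<bullet> (G x - p) = 0" by (metis inner_diff_left)
  then show "p \<in> range G" by auto
qed

lemma gradient_chart_measure:
  assumes gc: "gradient_chart K \<phi> G D" and K: "K \<in> convex_bodies"
  shows "((\<lambda>x. det (matrix (D x))) has_integral measure lebesgue K) UNIV"
proof -
  have sub: "interior K \<subseteq> range G" by (rule interior_subset_range_gradient[OF gc])
  have "range G \<subseteq> K" using gc unfolding gradient_chart_def by blast
  have KK: "convex K" "compact K" using K by (auto simp: convex_bodies_def)
  have bd: "bounded K" and neg: "negligible (frontier K)"
    using KK compact_imp_bounded negligible_convex_frontier by auto
  have im: "interior K \<in> lmeasurable" "K \<in> lmeasurable"
    using KK by (auto simp: lmeasurable_compact lmeasurable_interior bd)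
  have mi: "measure lebesgue (interior K) = measure lebesgue K"
    using measure_interior[OF bd neg] .
  have meas: "range G \<in> lmeasurable"
    using completion.complete_sets_sandwich_fmeasurable[OF im sub \<open>range G \<subseteq> K\<close>] mi by simp
  have eq: "measure lebesgue (range G) = measure lebesgue K"
    using measure_mono_fmeasurable[OF sub _ meas] measure_mono_fmeasurable[OF \<open>range G \<subseteq> K\<close> _ im(2)]
      mi im meas by (auto simp: fmeasurableD)
  have der: "(G has_derivative D x) (at x)" for x using gc unfolding gradient_chart_def by blast
  have inj: "inj G"
  proof (rule injI, rule ccontr)
    fix x y assume "G x = G y" "x \<noteq> y"
    moreover have "0 < (G x - G y) \<bullet> (x - y)"
      using gc \<open>x \<noteq> y\<close> unfolding gradient_chart_def by blast
    ultimately show False by simp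
  qed
  have "0 \<le> det (matrix (D x))" for x
    using gc det_nonneg_2[OF has_derivative_linear[OF der]] unfolding gradient_chart_def by blast
  then have ab: "(\<lambda>x. \<bar>det (matrix (D x))\<bar>) = (\<lambda>x. det (matrix (D x)))" by simp
  have int: "(\<lambda>x. det (matrix (D x))) integrable_on UNIV"
    using measurable_differentiable_image_eq[of UNIV G D] der inj meas ab by auto
  have "measure lebesgue (range G) = integral UNIV (\<lambda>x. det (matrix (D x)))"
    using measure_differentiable_image_eq[of UNIV G D] der inj int ab by auto
  with int eq show ?thesis by (simp add: has_integral_integral)
qed

lemma gradient_chart_polytope:
  fixes F :: "(real^2) set"
  assumes F: "finite F" and int: "interior (convex hull F) \<noteq> {}"
  shows "\<exists>\<phi> G D. gradient_chart (convex hull F) \<phi> G D"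
proof -
  have ne: "F \<noteq> {}" using int by auto
  define w where "w = (\<lambda>x v :: real^2. exp (v \<bullet> x))"
  define Z where "Z = (\<lambda>x. \<Sum>v\<in>F. w x v)"
  define \<phi> where "\<phi> = (\<lambda>x. ln (Z x))"
  define G where "G = (\<lambda>x. inverse (Z x) *\<^sub>R (\<Sum>v\<in>F. w x v *\<^sub>R v))"
  define D where "D = (\<lambda>x h. inverse (Z x) *\<^sub>R (\<Sum>v\<in>F. (w x v * (v \<bullet> h)) *\<^sub>R v)
     - (inverse (Z x) * (\<Sum>v\<in>F. w x v * (v \<bullet> h)) * inverse (Z x)) *\<^sub>R (\<Sum>v\<in>F. w x v *\<^sub>R v))"
  have w_pos: "w x v > 0" for x v by (simp add: w_def)
  have Z_pos: "Z x > 0" for x unfolding Z_def using F ne w_pos by (intro sum_pos) auto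
  have ZS: "sum (w x) F = Z x" for x by (simp add: Z_def)
  have Z_nz: "Z x \<noteq> 0" for x using Z_pos[of x] by simp
  have dw: "((\<lambda>x. w x v) has_derivative (\<lambda>h. w x v * (v \<bullet> h))) (at x)" for x v
    unfolding w_def by (auto intro!: derivative_eq_intros)
  have dZ: "(Z has_derivative (\<lambda>h. \<Sum>v\<in>F. w x v * (v \<bullet> h))) (at x)" for x
    unfolding Z_def by (intro has_derivative_sum dw)
  have d\<phi>: "(\<phi> has_derivative (\<bullet>) (G x)) (at x)" for x
  proof -
    have "(\<phi> has_derivative (\<lambda>h. (\<Sum>v\<in>F. w x v * (v \<bullet> h)) * inverse (Z x))) (at x)"
      unfolding \<phi>_def by (rule DERIV_compose_FDERIV[OF DERIV_ln[OF Z_pos] dZ])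
    moreover have "(\<lambda>h. (\<Sum>v\<in>F. w x v * (v \<bullet> h)) * inverse (Z x)) = (\<bullet>) (G x)"
      by (simp add: fun_eq_iff G_def inner_sum_left)
    ultimately show ?thesis by simp
  qed
  have dG: "(G has_derivative D x) (at x)" for x
  proof -
    have "((\<lambda>x. \<Sum>v\<in>F. w x v *\<^sub>R v) has_derivative (\<lambda>h. \<Sum>v\<in>F. (w x v * (v \<bullet> h)) *\<^sub>R v)) (at x)"
      by (intro has_derivative_sum has_derivative_scaleR_left dw)
    from has_derivative_scaleR[OF Deriv.has_derivative_inverse[OF Z_nz dZ] this]
    show ?thesis unfolding G_def D_def by simp
  qed
  have psd: "0 \<le> D x h \<bullet> h" for x h
  proof -
    define \<mu> where "\<mu> = inverse (Z x) * (\<Sum>v\<in>F. w x v * (v \<bullet> h))"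
    have S1: "(\<Sum>v\<in>F. w x v * (v \<bullet> h)) = Z x * \<mu>" using Z_nz[of x] by (simp add: \<mu>_def)
    have "0 \<le> (\<Sum>v\<in>F. w x v * (v \<bullet> h - \<mu>)\<^sup>2)"
      using w_pos by (intro sum_nonneg mult_nonneg_nonneg) (auto simp: less_imp_le)
    also have "\<dots> = (\<Sum>v\<in>F. w x v * (v \<bullet> h)\<^sup>2) - 2 * \<mu> * (\<Sum>v\<in>F. w x v * (v \<bullet> h)) + \<mu>\<^sup>2 * (\<Sum>v\<in>F. w x v)"
      by (simp add: sum_distrib_left sum.distrib[symmetric] sum_subtractf[symmetric] power2_eq_square algebra_simps)
    also have "\<dots> = (\<Sum>v\<in>F. w x v * (v \<bullet> h)\<^sup>2) - \<mu>\<^sup>2 * Z x"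
      unfolding S1 by (simp add: ZS power2_eq_square)
    also have "\<dots> = Z x * (D x h \<bullet> h)"
    proof -
      define Q where "Q = (\<Sum>v\<in>F. w x v * (v \<bullet> h)\<^sup>2)"
      have "D x h \<bullet> h = inverse (Z x) * Q - inverse (Z x) * (Z x * \<mu>) * inverse (Z x) * (Z x * \<mu>)"
        by (simp add: D_def Q_def inner_diff_left inner_sum_left S1 power2_eq_square mult.assoc)
      then show ?thesis
        unfolding Q_def[symmetric] using Z_nz[of x] by (simp add: power2_eq_square field_simps)
    qed
    finally show ?thesis using Z_pos[of x] by (simp add: zero_le_mult_iff)
  qed
  have mono: "0 < (G x - G y) \<bullet> (x - y)" if "x \<noteq> y" for x y
  proof -
    \<comment> \<open>With the log-weights \<open>a\<close>, \<open>b\<close> of the vertices at \<open>x\<close>, \<open>y\<close> this is the sum of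
      \<open>(exp a - exp b) (a - b)\<close>, which vanishes only if \<open>F\<close> lies on a line.\<close>
    define a where "a = (\<lambda>v. ln (w x v / Z x))"
    define b where "b = (\<lambda>v. ln (w y v / Z y))"
    have ab: "exp (a v) = w x v / Z x" "exp (b v) = w y v / Z y" for v
      using w_pos Z_pos by (simp_all add: a_def b_def)
    have diff: "v \<bullet> (x - y) = a v - b v + (\<phi> x - \<phi> y)" for v
      using w_pos Z_pos Z_nz by (simp add: a_def b_def \<phi>_def ln_div) (simp add: w_def inner_diff_right)
    have one: "(\<Sum>v\<in>F. exp (a v)) = 1" "(\<Sum>v\<in>F. exp (b v)) = 1"
      using Z_nz by (simp_all add: ab sum_divide_distrib[symmetric] ZS)
    have G: "G x = (\<Sum>v\<in>F. exp (a v) *\<^sub>R v)" "G y = (\<Sum>v\<in>F. exp (b v) *\<^sub>R v)"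
      by (simp_all add: G_def ab scaleR_sum_right divide_inverse mult.commute)
    have "(G x - G y) \<bullet> (x - y) = (\<Sum>v\<in>F. (exp (a v) - exp (b v)) * (v \<bullet> (x - y)))"
      by (simp add: G inner_diff_left inner_sum_left sum_subtractf left_diff_distrib)
    also have "\<dots> = (\<Sum>v\<in>F. (exp (a v) - exp (b v)) * (a v - b v)) + (\<phi> x - \<phi> y) * ((\<Sum>v\<in>F. exp (a v)) - (\<Sum>v\<in>F. exp (b v)))"
      unfolding diff
      by (simp add: sum_distrib_left sum.distrib[symmetric] sum_subtractf[symmetric] algebra_simps)
    also have "\<dots> = (\<Sum>v\<in>F. (exp (a v) - exp (b v)) * (a v - b v))"
      by (simp add: one)
    also have "\<dots> > 0"
    proof -
      have nn: "0 \<le> (exp s - exp r) * (s - r)" for s r :: real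
        by (cases "r \<le> s") (auto intro: mult_nonneg_nonneg mult_nonpos_nonpos)
      have "\<exists>v\<in>F. a v \<noteq> b v"
      proof (rule ccontr)
        assume "\<not> (\<exists>v\<in>F. a v \<noteq> b v)"
        then have "F \<subseteq> {v. (x - y) \<bullet> v = \<phi> x - \<phi> y}" using diff by (auto simp: inner_commute)
        then have "convex hull F \<subseteq> {v. (x - y) \<bullet> v = \<phi> x - \<phi> y}"
          by (intro hull_minimal) (auto simp: convex_hyperplane)
        then have "interior (convex hull F) \<subseteq> interior {v. (x - y) \<bullet> v = \<phi> x - \<phi> y}"
          by (rule interior_mono)
        then show False using int that by (simp add: interior_hyperplane)
      qed
      then obtain v where v: "v \<in> F" "a v \<noteq> b v" by blast
      then have "(exp (a v) - exp (b v)) * (a v - b v) \<noteq> 0" by simp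
      then have "0 < (exp (a v) - exp (b v)) * (a v - b v)" using nn[of "a v" "b v"] by linarith
      then show ?thesis using v F nn by (intro sum_pos2[of F v]) auto
    qed
    finally show ?thesis .
  qed
  have GK: "G x \<in> convex hull F" for x
  proof -
    have "(\<Sum>v\<in>F. (inverse (Z x) * w x v) *\<^sub>R v) \<in> convex hull F"
      using F w_pos Z_pos Z_nz
      by (intro convex_sum) (auto simp: hull_inc less_imp_le sum_distrib_left[symmetric] ZS)
    then show ?thesis by (simp add: G_def scaleR_sum_right)
  qed
  have bound: "p \<bullet> x \<le> \<phi> x + 0" if "p \<in> convex hull F" for p x
  proof -
    have "v \<bullet> x \<le> \<phi> x" if "v \<in> F" for v
    proof -
      have "w x v \<le> Z x" unfolding Z_def using F that w_pos by (intro member_le_sum) (auto simp: less_imp_le)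
      then have "ln (w x v) \<le> \<phi> x" unfolding \<phi>_def using w_pos Z_pos by (subst ln_le_cancel_iff) auto
      then show ?thesis by (simp add: w_def)
    qed
    then have "convex hull F \<subseteq> {v. x \<bullet> v \<le> \<phi> x}"
      by (intro hull_minimal convex_halfspace_le) (auto simp: inner_commute)
    then show ?thesis using that by (auto simp: inner_commute)
  qed
  have "gradient_chart (convex hull F) \<phi> G D"
    unfolding gradient_chart_def using d\<phi> dG psd mono GK bound by blast
  then show ?thesis by blast
qed

subsection \<open>Area of Minkowski sums\<close>

lemma gradient_chart_sum:
  assumes "finite I" "I \<noteq> {}" "\<And>i. i \<in> I \<Longrightarrow> 0 < a i"
    and "\<And>i. i \<in> I \<Longrightarrow> gradient_chart (P i) (\<phi> i) (G i) (D i)"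
  shows "gradient_chart (\<Sum>i\<in>I. (*\<^sub>R) (a i) ` P i) (\<lambda>x. \<Sum>i\<in>I. a i * \<phi> i x)
    (\<lambda>x. \<Sum>i\<in>I. a i *\<^sub>R G i x) (\<lambda>x h. \<Sum>i\<in>I. a i *\<^sub>R D i x h)"
  using assms
proof (induction I rule: finite_ne_induct)
  case (singleton i)
  then show ?case by (simp add: gradient_chart_scale)
next
  case (insert i I)
  have "gradient_chart ((*\<^sub>R) (a i) ` P i) (\<lambda>x. a i * \<phi> i x) (\<lambda>x. a i *\<^sub>R G i x) (\<lambda>x h. a i *\<^sub>R D i x h)"
    using insert.prems by (intro gradient_chart_scale) auto
  from gradient_chart_add[OF this insert.IH[OF insert.prems]] insert.hyps
  show ?case by simp
qed

lemma convex_bodies_plus: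
  assumes "X \<in> convex_bodies" "Y \<in> convex_bodies"
  shows "X + Y \<in> convex_bodies"
proof -
  have "X + Y = {x + y | x y. x \<in> X \<and> y \<in> Y}" by (auto simp: set_plus_def)
  then have "compact (X + Y)"
    using assms compact_sums[of X Y] by (simp add: convex_bodies_def)
  moreover have "X + Y \<noteq> {}" using assms by (auto simp: convex_bodies_def set_plus_def)
  ultimately show ?thesis using assms by (simp add: convex_bodies_def convex_set_plus)
qed

lemma convex_bodies_linear_image:
  assumes "linear f" "X \<in> convex_bodies"
  shows "f ` X \<in> convex_bodies"
  using assms by (auto simp: convex_bodies_def convex_linear_image linear_conv_bounded_linear
      intro: compact_continuous_image linear_continuous_on)

lemma convex_bodies_scale: "X \<in> convex_bodies \<Longrightarrow> (*\<^sub>R) c ` X \<in> convex_bodies"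
  by (intro convex_bodies_linear_image) auto

lemma convex_bodies_zero: "{0} \<in> convex_bodies"
  by (simp add: convex_bodies_def)

lemma convex_bodies_sum:
  "(\<And>i. i \<in> I \<Longrightarrow> X i \<in> convex_bodies) \<Longrightarrow> (\<Sum>i\<in>I. X i) \<in> convex_bodies"
  by (induction I rule: infinite_finite_induct) (auto simp: convex_bodies_plus convex_bodies_zero)

definition mixed_det :: "(real^2 \<Rightarrow> real^2) \<Rightarrow> (real^2 \<Rightarrow> real^2) \<Rightarrow> real" where
  "mixed_det f g = (det (matrix (\<lambda>h. f h + g h)) - det (matrix f) - det (matrix g)) / 2"

lemma mixed_det_eq:
  "mixed_det f g = (f (axis 1 1) $ 1 * g (axis 2 1) $ 2 - f (axis 2 1) $ 1 * g (axis 1 1) $ 2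
     + (g (axis 1 1) $ 1 * f (axis 2 1) $ 2 - g (axis 2 1) $ 1 * f (axis 1 1) $ 2)) / 2"
  by (simp add: mixed_det_def det_2 matrix_def algebra_simps)

lemma det_matrix_sum:
  assumes "finite I"
  shows "det (matrix (\<lambda>h. \<Sum>i\<in>I. a i *\<^sub>R f i h)) = (\<Sum>i\<in>I. \<Sum>j\<in>I. a i * a j * mixed_det (f i) (f j))"
proof -
  define u where "u i j = a i * a j * (f i (axis 1 1) $ 1 * f j (axis 2 1) $ 2 - f i (axis 2 1) $ 1 * f j (axis 1 1) $ 2)" for i j
  have "det (matrix (\<lambda>h. \<Sum>i\<in>I. a i *\<^sub>R f i h)) =
      (\<Sum>i\<in>I. a i * f i (axis 1 1) $ 1) * (\<Sum>i\<in>I. a i * f i (axis 2 1) $ 2) -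
      (\<Sum>i\<in>I. a i * f i (axis 2 1) $ 1) * (\<Sum>i\<in>I. a i * f i (axis 1 1) $ 2)"
    by (simp add: det_2 matrix_def)
  also have "\<dots> = (\<Sum>i\<in>I. \<Sum>j\<in>I. u i j)"
    unfolding sum_product u_def sum_subtractf[symmetric] by (simp add: algebra_simps)
  finally have "det (matrix (\<lambda>h. \<Sum>i\<in>I. a i *\<^sub>R f i h)) = (\<Sum>i\<in>I. \<Sum>j\<in>I. u i j)" .
  moreover have "(\<Sum>i\<in>I. \<Sum>j\<in>I. u i j) = (\<Sum>i\<in>I. \<Sum>j\<in>I. u j i)"
    by (rule sum.swap)
  ultimately have "det (matrix (\<lambda>h. \<Sum>i\<in>I. a i *\<^sub>R f i h)) = (\<Sum>i\<in>I. \<Sum>j\<in>I. (u i j + u j i) / 2)"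
    by (simp add: sum.distrib sum_divide_distrib[symmetric])
  also have "\<dots> = (\<Sum>i\<in>I. \<Sum>j\<in>I. a i * a j * mixed_det (f i) (f j))"
    by (intro sum.cong refl) (simp add: u_def mixed_det_eq algebra_simps)
  finally show ?thesis .
qed

lemma measure_sum_polytopes:
  fixes F :: "'i \<Rightarrow> (real^2) set"
  assumes I: "finite I" and a: "\<And>i. i \<in> I \<Longrightarrow> 0 \<le> a i"
    and F: "\<And>i. i \<in> I \<Longrightarrow> finite (F i)" "\<And>i. i \<in> I \<Longrightarrow> interior (convex hull F i) \<noteq> {}"
  shows "measure lebesgue (\<Sum>i\<in>I. (*\<^sub>R) (a i) ` (convex hull F i)) =
    (\<Sum>i\<in>I. \<Sum>j\<in>I. a i * a j * mixed_area (convex hull F i) (convex hull F j))"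
proof -
  define P where "P i = convex hull F i" for i
  have cb: "P i \<in> convex_bodies" if "i \<in> I" for i
    using F[OF that] interior_subset[of "convex hull F i"]
    by (auto simp: convex_bodies_def P_def finite_imp_compact_convex_hull)
  have "\<forall>i\<in>I. \<exists>\<phi> G D. gradient_chart (P i) \<phi> G D"
    using F gradient_chart_polytope by (auto simp: P_def)
  then obtain \<phi> G D where gc: "\<And>i. i \<in> I \<Longrightarrow> gradient_chart (P i) (\<phi> i) (G i) (D i)"
    by metis
  have mixed: "((\<lambda>x. mixed_det (D i x) (D j x)) has_integral mixed_area (P i) (P j)) UNIV"
    if "i \<in> I" "j \<in> I" for i j
    unfolding mixed_det_def mixed_area_def
    by (intro has_integral_divide has_integral_diff
        gradient_chart_measure[OF gradient_chart_add[OF gc[OF that(1)] gc[OF that(2)]]]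
        gradient_chart_measure[OF gc[OF that(1)]] gradient_chart_measure[OF gc[OF that(2)]]
        convex_bodies_plus cb that)
  define J where "J = {i \<in> I. 0 < a i}"
  have J: "finite J" "J \<subseteq> I" "\<And>i. i \<in> I - J \<Longrightarrow> a i = 0" using I a by (auto simp: J_def less_le)
  have "(\<Sum>i\<in>I. (*\<^sub>R) (a i) ` P i) = (\<Sum>i\<in>J. (*\<^sub>R) (a i) ` P i)"
  proof (intro sum.mono_neutral_right I J ballI)
    fix i assume "i \<in> I - J"
    then show "(*\<^sub>R) (a i) ` P i = 0"
      using J(3) cb[of i] by (auto simp: convex_bodies_def set_zero)
  qed
  also have "measure lebesgue \<dots> = (\<Sum>i\<in>J. \<Sum>j\<in>J. a i * a j * mixed_area (P i) (P j))"
  proof (cases "J = {}")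
    case False
    have "gradient_chart (\<Sum>i\<in>J. (*\<^sub>R) (a i) ` P i) (\<lambda>x. \<Sum>i\<in>J. a i * \<phi> i x)
      (\<lambda>x. \<Sum>i\<in>J. a i *\<^sub>R G i x) (\<lambda>x h. \<Sum>i\<in>J. a i *\<^sub>R D i x h)"
      by (intro gradient_chart_sum gc J(1) False) (auto simp: J_def)
    moreover have "(\<Sum>i\<in>J. (*\<^sub>R) (a i) ` P i) \<in> convex_bodies"
      using J cb by (intro convex_bodies_sum convex_bodies_scale) auto
    ultimately have "((\<lambda>x. det (matrix (\<lambda>h. \<Sum>i\<in>J. a i *\<^sub>R D i x h))) has_integral
        measure lebesgue (\<Sum>i\<in>J. (*\<^sub>R) (a i) ` P i)) UNIV"
      by (rule gradient_chart_measure)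
    moreover have "((\<lambda>x. det (matrix (\<lambda>h. \<Sum>i\<in>J. a i *\<^sub>R D i x h))) has_integral
        (\<Sum>i\<in>J. \<Sum>j\<in>J. a i * a j * mixed_area (P i) (P j))) UNIV"
      unfolding det_matrix_sum[OF J(1)] using J
      by (intro has_integral_sum has_integral_mult_right mixed) auto
    ultimately show ?thesis by (rule has_integral_unique)
  qed (simp add: set_zero)
  also have "\<dots> = (\<Sum>i\<in>I. \<Sum>j\<in>J. a i * a j * mixed_area (P i) (P j))"
    using J I by (intro sum.mono_neutral_left) auto
  also have "\<dots> = (\<Sum>i\<in>I. \<Sum>j\<in>I. a i * a j * mixed_area (P i) (P j))"
    using J I by (intro sum.cong refl sum.mono_neutral_left) auto
  finally show ?thesis by (simp add: P_def)
qed

definition inner_approx :: "real \<Rightarrow> 'a::euclidean_space set \<Rightarrow> 'a set \<Rightarrow> bool" where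
  "inner_approx \<epsilon> P K \<longleftrightarrow> P \<in> convex_bodies \<and> K \<in> convex_bodies \<and> P \<subseteq> K \<and>
     (\<exists>z. K \<subseteq> (\<lambda>x. (1 + \<epsilon>) *\<^sub>R x + z) ` P)"

lemma inner_approx_plus:
  assumes "inner_approx \<epsilon> P K" "inner_approx \<epsilon> P' K'"
  shows "inner_approx \<epsilon> (P + P') (K + K')"
proof -
  obtain z z' where z: "K \<subseteq> (\<lambda>x. (1 + \<epsilon>) *\<^sub>R x + z) ` P" "K' \<subseteq> (\<lambda>x. (1 + \<epsilon>) *\<^sub>R x + z') ` P'"
    using assms by (auto simp: inner_approx_def)
  have "K + K' \<subseteq> (\<lambda>x. (1 + \<epsilon>) *\<^sub>R x + (z + z')) ` (P + P')"
  proof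
    fix k assume "k \<in> K + K'"
    then obtain x x' where "x \<in> P" "x' \<in> P'" "k = ((1 + \<epsilon>) *\<^sub>R x + z) + ((1 + \<epsilon>) *\<^sub>R x' + z')"
      using z by (blast elim: set_plus_elim)
    then show "k \<in> (\<lambda>x. (1 + \<epsilon>) *\<^sub>R x + (z + z')) ` (P + P')"
      by (intro image_eqI[of _ _ "x + x'"] set_plus_intro) (simp_all add: algebra_simps)
  qed
  moreover have "P + P' \<subseteq> K + K'"
    using assms by (intro set_plus_mono2) (auto simp: inner_approx_def)
  ultimately show ?thesis
    using assms convex_bodies_plus unfolding inner_approx_def by blast
qed

lemma inner_approx_scale:
  assumes "inner_approx \<epsilon> P K"
  shows "inner_approx \<epsilon> ((*\<^sub>R) c ` P) ((*\<^sub>R) c ` K)"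
proof -
  obtain z where z: "K \<subseteq> (\<lambda>x. (1 + \<epsilon>) *\<^sub>R x + z) ` P"
    using assms by (auto simp: inner_approx_def)
  have "(*\<^sub>R) c ` K \<subseteq> (\<lambda>x. (1 + \<epsilon>) *\<^sub>R x + c *\<^sub>R z) ` (*\<^sub>R) c ` P"
  proof
    fix k assume "k \<in> (*\<^sub>R) c ` K"
    then obtain x where "x \<in> P" "k = c *\<^sub>R ((1 + \<epsilon>) *\<^sub>R x + z)" using z by blast
    then show "k \<in> (\<lambda>x. (1 + \<epsilon>) *\<^sub>R x + c *\<^sub>R z) ` (*\<^sub>R) c ` P"
      by (intro image_eqI[of _ _ "c *\<^sub>R x"] imageI) (simp_all add: algebra_simps)
  qed
  then show ?thesis
    using assms by (auto simp: inner_approx_def convex_bodies_scale)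
qed

lemma inner_approx_sum:
  "(\<And>i. i \<in> I \<Longrightarrow> inner_approx \<epsilon> (P i) (K i)) \<Longrightarrow> inner_approx \<epsilon> (\<Sum>i\<in>I. P i) (\<Sum>i\<in>I. K i)"
proof (induction I rule: infinite_finite_induct)
  case (insert i I)
  then show ?case by (simp add: inner_approx_plus)
qed (auto simp: inner_approx_def convex_bodies_zero)

lemma inner_approx_measure_tendsto:
  fixes K :: "'a::euclidean_space set"
  assumes "\<And>n. inner_approx (1 / real (Suc n)) (P n) K"
  shows "(\<lambda>n. measure lebesgue (P n)) \<longlonglongrightarrow> measure lebesgue K"
proof (rule tendsto_sandwich)
  have K: "K \<in> convex_bodies" and P: "P n \<in> convex_bodies" "P n \<subseteq> K" for n
    using assms by (auto simp: inner_approx_def)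
  have meas: "X \<in> lmeasurable" if "X \<in> convex_bodies" for X :: "'a set"
    using that by (simp add: convex_bodies_def lmeasurable_compact)
  show "\<forall>\<^sub>F n in sequentially. measure lebesgue (P n) \<le> measure lebesgue K"
    by (intro always_eventually allI measure_mono_fmeasurable P) (use meas K P in \<open>auto simp: fmeasurableD\<close>)
  show "\<forall>\<^sub>F n in sequentially. measure lebesgue K / (1 + 1 / real (Suc n)) ^ DIM('a) \<le> measure lebesgue (P n)"
  proof (intro always_eventually allI)
    fix n
    define s where "s = 1 + 1 / real (Suc n)"
    have "s > 0" by (simp add: s_def add_pos_nonneg)
    obtain z where z: "K \<subseteq> (\<lambda>x. s *\<^sub>R x + z) ` P n"
      using assms[of n] by (auto simp: inner_approx_def s_def)
    have "compact ((\<lambda>x. s *\<^sub>R x + z) ` P n)"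
      using P by (intro compact_continuous_image continuous_intros) (auto simp: convex_bodies_def)
    then have "measure lebesgue K \<le> measure lebesgue ((\<lambda>x. s *\<^sub>R x + z) ` P n)"
      using z meas[OF K] by (intro measure_mono_fmeasurable) (auto simp: fmeasurableD lmeasurable_compact)
    also have "\<dots> = s ^ DIM('a) * measure lebesgue (P n)"
      using measure_lebesgue_affine[of s z "P n"] \<open>s > 0\<close> by simp
    finally show "measure lebesgue K / (1 + 1 / real (Suc n)) ^ DIM('a) \<le> measure lebesgue (P n)"
      using \<open>s > 0\<close> unfolding s_def[symmetric] by (simp add: field_simps)
  qed
  have "(\<lambda>n. measure lebesgue K / (1 + 1 / real (Suc n)) ^ DIM('a)) \<longlonglongrightarrow> measure lebesgue K / (1 + 0) ^ DIM('a)"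
    by (intro tendsto_intros LIMSEQ_Suc[OF lim_1_over_n] filterlim_compose[OF lim_1_over_n filterlim_Suc]) auto
  then show "(\<lambda>n. measure lebesgue K / (1 + 1 / real (Suc n)) ^ DIM('a)) \<longlonglongrightarrow> measure lebesgue K"
    by simp
qed simp

lemma mixed_area_inner_approx_tendsto:
  assumes "\<And>n. inner_approx (1 / real (Suc n)) (P n) K" "\<And>n. inner_approx (1 / real (Suc n)) (P' n) K'"
  shows "(\<lambda>n. mixed_area (P n) (P' n)) \<longlonglongrightarrow> mixed_area K K'"
  unfolding mixed_area_def
  by (intro tendsto_intros inner_approx_measure_tendsto inner_approx_plus assms) auto

lemma inner_approx_polytope:
  fixes K :: "'a::euclidean_space set"
  assumes K: "K \<in> solid_convex_bodies" and "0 < \<epsilon>"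
  obtains F where "finite F" "interior (convex hull F) \<noteq> {}" "inner_approx \<epsilon> (convex hull F) K"
proof -
  have cK: "convex K" "compact K" "K \<in> convex_bodies"
    using K by (auto simp: solid_convex_bodies_def convex_bodies_def)
  obtain c where c: "c \<in> interior K" using K by (auto simp: solid_convex_bodies_def)
  define g where "g x = x - (\<epsilon> / (1 + \<epsilon>)) *\<^sub>R (x - c)" for x
  have g: "g x \<in> interior K" if "x \<in> K" for x
    unfolding g_def using cK c that \<open>0 < \<epsilon>\<close> by (intro mem_interior_convex_shrink) auto
  have "\<exists>B S. open B \<and> x \<in> B \<and> finite S \<and> B \<subseteq> convex hull S \<and> convex hull S \<subseteq> K" if x: "x \<in> interior K" for x
  proof -
    obtain a b where ab: "cbox a b \<subseteq> interior K" "x \<in> box a b"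
      using open_contains_cbox[OF open_interior x] by metis
    obtain S where S: "finite S" "cbox a b = convex hull S"
      using closed_interval_as_convex_hull by blast
    then show ?thesis
      using ab box_subset_cbox[of a b] interior_subset[of K] open_box
      by (intro exI[of _ "box a b"] exI[of _ S]) auto
  qed
  then obtain B S where BS: "\<And>x. x \<in> interior K \<Longrightarrow> open (B x) \<and> x \<in> B x \<and> finite (S x) \<and>
      B x \<subseteq> convex hull (S x) \<and> convex hull (S x) \<subseteq> K" by metis
  have "compact (g ` K)"
    unfolding g_def by (intro compact_continuous_image continuous_intros cK)
  moreover have "g ` K \<subseteq> (\<Union>y\<in>interior K. B y)" using g BS by blast
  ultimately obtain T where T: "T \<subseteq> interior K" "finite T" "g ` K \<subseteq> (\<Union>y\<in>T. B y)"
    using BS by (metis (no_types, lifting) compactE_image)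
  define F where "F = (\<Union>y\<in>T. S y)"
  have "finite F" using T BS by (auto simp: F_def)
  have sub: "convex hull (S y) \<subseteq> convex hull F" if "y \<in> T" for y
    using that by (intro hull_mono) (auto simp: F_def)
  have gF: "g ` K \<subseteq> convex hull F" using T BS sub by blast
  have "g c \<in> (\<Union>y\<in>T. B y)" using T c interior_subset by blast
  then obtain y where "y \<in> T" "g c \<in> B y" by blast
  then have "g c \<in> interior (convex hull F)"
    using BS[of y] sub[of y] T by (meson in_mono interiorI subset_trans)
  then have int: "interior (convex hull F) \<noteq> {}" by blast
  have "S y \<subseteq> K" if "y \<in> T" for y
    using BS[of y] T that hull_subset[of "S y" convex] by (meson in_mono subset_trans)
  then have "F \<subseteq> K" by (auto simp: F_def)
  then have FK: "convex hull F \<subseteq> K" using cK by (intro hull_minimal)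
  have "K \<subseteq> (\<lambda>x. (1 + \<epsilon>) *\<^sub>R x + - \<epsilon> *\<^sub>R c) ` (convex hull F)"
  proof
    fix x assume "x \<in> K"
    have "(1 + \<epsilon>) *\<^sub>R g x = (1 + \<epsilon>) *\<^sub>R x - ((1 + \<epsilon>) * (\<epsilon> / (1 + \<epsilon>))) *\<^sub>R (x - c)"
      unfolding g_def by (simp only: scaleR_diff_right[of "1 + \<epsilon>"] scaleR_scaleR)
    also have "(1 + \<epsilon>) * (\<epsilon> / (1 + \<epsilon>)) = \<epsilon>" using \<open>0 < \<epsilon>\<close> by simp
    finally have "x = (1 + \<epsilon>) *\<^sub>R g x + - \<epsilon> *\<^sub>R c" by (simp add: algebra_simps)
    then show "x \<in> (\<lambda>x. (1 + \<epsilon>) *\<^sub>R x + - \<epsilon> *\<^sub>R c) ` (convex hull F)"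
      using gF \<open>x \<in> K\<close> by blast
  qed
  moreover have "convex hull F \<in> convex_bodies"
    using \<open>finite F\<close> int interior_subset[of "convex hull F"]
    by (auto simp: convex_bodies_def finite_imp_compact_convex_hull)
  ultimately have "inner_approx \<epsilon> (convex hull F) K"
    using cK FK unfolding inner_approx_def by blast
  then show ?thesis using that \<open>finite F\<close> int by blast
qed

theorem measure_sum_convex_bodies:
  fixes K :: "'i \<Rightarrow> (real^2) set"
  assumes I: "finite I" and a: "\<And>i. i \<in> I \<Longrightarrow> 0 \<le> a i"
    and K: "\<And>i. i \<in> I \<Longrightarrow> K i \<in> solid_convex_bodies"
  shows "measure lebesgue (\<Sum>i\<in>I. (*\<^sub>R) (a i) ` K i) = (\<Sum>i\<in>I. \<Sum>j\<in>I. a i * a j * mixed_area (K i) (K j))"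
proof -
  have "\<forall>n. \<forall>i\<in>I. \<exists>F. finite F \<and> interior (convex hull F) \<noteq> {} \<and> inner_approx (1 / real (Suc n)) (convex hull F) (K i)"
    using K by (metis inner_approx_polytope of_nat_0_less_iff zero_less_Suc zero_less_divide_1_iff)
  then obtain F where F: "\<And>n i. i \<in> I \<Longrightarrow> finite (F n i)"
      "\<And>n i. i \<in> I \<Longrightarrow> interior (convex hull F n i) \<noteq> {}"
      "\<And>n i. i \<in> I \<Longrightarrow> inner_approx (1 / real (Suc n)) (convex hull F n i) (K i)"
    by metis
  have "(\<lambda>n. measure lebesgue (\<Sum>i\<in>I. (*\<^sub>R) (a i) ` (convex hull F n i)))
      \<longlonglongrightarrow> measure lebesgue (\<Sum>i\<in>I. (*\<^sub>R) (a i) ` K i)"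
    by (intro inner_approx_measure_tendsto inner_approx_sum inner_approx_scale F)
  moreover have "(\<lambda>n. \<Sum>i\<in>I. \<Sum>j\<in>I. a i * a j * mixed_area (convex hull F n i) (convex hull F n j))
      \<longlonglongrightarrow> (\<Sum>i\<in>I. \<Sum>j\<in>I. a i * a j * mixed_area (K i) (K j))"
    by (intro tendsto_sum tendsto_mult tendsto_const mixed_area_inner_approx_tendsto F)
  moreover have "measure lebesgue (\<Sum>i\<in>I. (*\<^sub>R) (a i) ` (convex hull F n i)) =
      (\<Sum>i\<in>I. \<Sum>j\<in>I. a i * a j * mixed_area (convex hull F n i) (convex hull F n j))" for n
    using I a F by (intro measure_sum_polytopes) auto
  ultimately show ?thesis by (simp add: LIMSEQ_unique)
qed

lemma mixed_area_commute: "mixed_area X Y = mixed_area Y X"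
  by (simp add: mixed_area_def add.commute)

theorem mixed_area_sum_sum:
  assumes I: "finite I" "\<And>i. i \<in> I \<Longrightarrow> 0 \<le> a i" "\<And>i. i \<in> I \<Longrightarrow> K i \<in> solid_convex_bodies"
    and J: "finite J" "\<And>j. j \<in> J \<Longrightarrow> 0 \<le> b j" "\<And>j. j \<in> J \<Longrightarrow> L j \<in> solid_convex_bodies"
  shows "mixed_area (\<Sum>i\<in>I. (*\<^sub>R) (a i) ` K i) (\<Sum>j\<in>J. (*\<^sub>R) (b j) ` L j) =
    (\<Sum>i\<in>I. \<Sum>j\<in>J. a i * b j * mixed_area (K i) (L j))"
proof -
  define c where "c = case_sum a b"
  define M where "M = case_sum K L"
  have "measure lebesgue (\<Sum>k\<in>I <+> J. (*\<^sub>R) (c k) ` M k) =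
      (\<Sum>k\<in>I <+> J. \<Sum>l\<in>I <+> J. c k * c l * mixed_area (M k) (M l))"
    using I J by (intro measure_sum_convex_bodies) (auto simp: c_def M_def)
  then have "measure lebesgue ((\<Sum>i\<in>I. (*\<^sub>R) (a i) ` K i) + (\<Sum>j\<in>J. (*\<^sub>R) (b j) ` L j)) =
      (\<Sum>i\<in>I. (\<Sum>j\<in>I. a i * a j * mixed_area (K i) (K j)) + (\<Sum>j\<in>J. a i * b j * mixed_area (K i) (L j))) +
      (\<Sum>i\<in>J. (\<Sum>j\<in>I. b i * a j * mixed_area (L i) (K j)) + (\<Sum>j\<in>J. b i * b j * mixed_area (L i) (L j)))"
    using I(1) J(1) by (simp add: sum.Plus c_def M_def)
  moreover have "(\<Sum>i\<in>J. \<Sum>j\<in>I. b i * a j * mixed_area (L i) (K j)) =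
      (\<Sum>i\<in>I. \<Sum>j\<in>J. a i * b j * mixed_area (K i) (L j))"
    by (subst sum.swap) (simp add: mixed_area_commute mult.commute)
  ultimately show ?thesis
    using measure_sum_convex_bodies[OF I] measure_sum_convex_bodies[OF J]
    by (simp add: mixed_area_def[of "sum _ _"] sum.distrib)
qed

subsection \<open>Support functions and Hukuhara derivatives\<close>

definition support_fun :: "'a::euclidean_space set \<Rightarrow> 'a \<Rightarrow> real" where
  "support_fun K u = (SUP x\<in>K. u \<bullet> x)"

lemma support_fun_eqI:
  "x \<in> K \<Longrightarrow> (\<And>y. y \<in> K \<Longrightarrow> u \<bullet> y \<le> u \<bullet> x) \<Longrightarrow> support_fun K u = u \<bullet> x"
  unfolding support_fun_def by (rule cSup_eq_maximum) auto

lemma support_fun_attained: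
  assumes "K \<in> convex_bodies"
  obtains x where "x \<in> K" "support_fun K u = u \<bullet> x" "\<And>y. y \<in> K \<Longrightarrow> u \<bullet> y \<le> u \<bullet> x"
proof -
  have "compact K" "K \<noteq> {}" using assms by (auto simp: convex_bodies_def)
  moreover have "continuous_on K ((\<bullet>) u)" by (intro continuous_intros)
  ultimately obtain x where "x \<in> K" "\<And>y. y \<in> K \<Longrightarrow> u \<bullet> y \<le> u \<bullet> x"
    using continuous_attains_sup[of K "(\<bullet>) u"] by blast
  with support_fun_eqI that show ?thesis by blast
qed

lemma inner_le_support_fun: "K \<in> convex_bodies \<Longrightarrow> x \<in> K \<Longrightarrow> u \<bullet> x \<le> support_fun K u"
  by (metis support_fun_attained)

lemma support_fun_zero [simp]: "support_fun {0} u = 0"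
  by (simp add: support_fun_def)

lemma support_fun_plus:
  assumes "K \<in> convex_bodies" "L \<in> convex_bodies"
  shows "support_fun (K + L) u = support_fun K u + support_fun L u"
proof -
  obtain x where x: "x \<in> K" "support_fun K u = u \<bullet> x" "\<And>y. y \<in> K \<Longrightarrow> u \<bullet> y \<le> u \<bullet> x"
    using support_fun_attained[OF assms(1)] by blast
  obtain y where y: "y \<in> L" "support_fun L u = u \<bullet> y" "\<And>z. z \<in> L \<Longrightarrow> u \<bullet> z \<le> u \<bullet> y"
    using support_fun_attained[OF assms(2)] by blast
  have "support_fun (K + L) u = u \<bullet> (x + y)"
  proof (rule support_fun_eqI)
    fix z assume "z \<in> K + L"
    then obtain x' y' where "x' \<in> K" "y' \<in> L" "z = x' + y'" by (rule set_plus_elim)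
    then show "u \<bullet> z \<le> u \<bullet> (x + y)" using x(3)[of x'] y(3)[of y'] by (simp add: inner_add_right)
  qed (use x y in blast)
  then show ?thesis using x y by (simp add: inner_add_right)
qed

lemma support_fun_scale:
  assumes "K \<in> convex_bodies" "0 \<le> c"
  shows "support_fun ((*\<^sub>R) c ` K) u = c * support_fun K u"
proof -
  obtain x where x: "x \<in> K" "support_fun K u = u \<bullet> x" "\<And>y. y \<in> K \<Longrightarrow> u \<bullet> y \<le> u \<bullet> x"
    using support_fun_attained[OF assms(1)] by blast
  have "support_fun ((*\<^sub>R) c ` K) u = u \<bullet> (c *\<^sub>R x)"
    by (rule support_fun_eqI) (use x assms in \<open>auto simp: mult_left_mono\<close>)
  then show ?thesis using x by simp
qed

lemma support_fun_sum:
  "(\<And>i. i \<in> I \<Longrightarrow> K i \<in> convex_bodies) \<Longrightarrow> support_fun (\<Sum>i\<in>I. K i) u = (\<Sum>i\<in>I. support_fun (K i) u)"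
  by (induction I rule: infinite_finite_induct) (auto simp: support_fun_plus convex_bodies_sum)

lemma support_fun_linear_image:
  assumes "linear f" "K \<in> convex_bodies"
  shows "support_fun (f ` K) u = support_fun K (adjoint f u)"
proof -
  obtain x where x: "x \<in> K" "support_fun K (adjoint f u) = adjoint f u \<bullet> x"
    "\<And>y. y \<in> K \<Longrightarrow> adjoint f u \<bullet> y \<le> adjoint f u \<bullet> x"
    using support_fun_attained[OF assms(2)] by blast
  have "support_fun (f ` K) u = u \<bullet> f x"
    by (rule support_fun_eqI) (use x assms in \<open>auto simp: adjoint_clauses\<close>)
  then show ?thesis using x assms by (simp add: adjoint_clauses)
qed

lemma support_fun_le_imp_subset:
  assumes "K \<in> convex_bodies" "L \<in> convex_bodies" "\<And>u. support_fun K u \<le> support_fun L u"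
  shows "K \<subseteq> L"
proof (rule subsetI, rule ccontr)
  fix z assume z: "z \<in> K" "z \<notin> L"
  have "convex L" "closed L" using assms by (auto simp: convex_bodies_def compact_imp_closed)
  with z obtain a b where ab: "a \<bullet> z < b" "\<And>x. x \<in> L \<Longrightarrow> b < a \<bullet> x"
    using separating_hyperplane_closed_point[of L z] by blast
  obtain y where y: "y \<in> L" "support_fun L (- a) = - a \<bullet> y"
    using support_fun_attained[OF assms(2)] by blast
  have "- a \<bullet> z \<le> support_fun K (- a)" using assms z by (intro inner_le_support_fun)
  then show False using assms(3)[of "- a"] y ab(1) ab(2)[OF y(1)] by simp
qed

lemma support_fun_inject:
  "K \<in> convex_bodies \<Longrightarrow> L \<in> convex_bodies \<Longrightarrow> (\<And>u. support_fun K u = support_fun L u) \<Longrightarrow> K = L"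
  by (intro equalityI support_fun_le_imp_subset) auto

lemma hausdorff_dist_commute: "hausdorff_dist K L = hausdorff_dist L K"
  by (simp add: hausdorff_dist_def max.commute)

lemma support_fun_diff_le_hausdorff_dist:
  assumes "K \<in> convex_bodies" "L \<in> convex_bodies"
  shows "\<bar>support_fun K u - support_fun L u\<bar> \<le> norm u * hausdorff_dist K L"
proof -
  have le: "support_fun K u - support_fun L u \<le> norm u * hausdorff_dist K L"
    if KL: "K \<in> convex_bodies" "L \<in> convex_bodies" for K L :: "'a set"
  proof -
    obtain x where x: "x \<in> K" "support_fun K u = u \<bullet> x"
      using support_fun_attained[OF KL(1)] by blast
    have "closed L" "L \<noteq> {}" using KL by (auto simp: convex_bodies_def compact_imp_closed)
    then obtain y where y: "y \<in> L" "infdist x L = dist x y"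
      using infdist_attains_inf by metis
    have "compact ((\<lambda>x. infdist x L) ` K)"
      using KL by (intro compact_continuous_image continuous_intros) (auto simp: convex_bodies_def)
    then have "bdd_above ((\<lambda>x. infdist x L) ` K)"
      by (intro bounded_imp_bdd_above compact_imp_bounded)
    then have "infdist x L \<le> (SUP x\<in>K. infdist x L)" using x by (intro cSUP_upper)
    then have "dist x y \<le> hausdorff_dist K L" using y by (simp add: hausdorff_dist_def)
    have "u \<bullet> x = u \<bullet> y + u \<bullet> (x - y)" by (simp add: inner_diff_right)
    also have "\<dots> \<le> support_fun L u + norm u * dist x y"
      using KL y by (intro add_mono inner_le_support_fun) (auto simp: dist_norm norm_cauchy_schwarz)
    also have "\<dots> \<le> support_fun L u + norm u * hausdorff_dist K L"
      using \<open>dist x y \<le> hausdorff_dist K L\<close> by (intro add_left_mono mult_left_mono) auto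
    finally show ?thesis using x by simp
  qed
  show ?thesis
    using le[OF assms] le[OF assms(2,1)] by (simp add: abs_le_iff hausdorff_dist_commute)
qed

lemma hukuhara_quotient_tendsto:
  assumes D: "D \<in> convex_bodies"
    and ev: "\<forall>\<^sub>F h in at_right 0. Y h \<in> convex_bodies \<and> hukuhara_diff_exists (X h) (Y h)"
    and lim: "((\<lambda>h. hausdorff_dist ((*\<^sub>R) (inverse h) ` hukuhara_diff (X h) (Y h)) D) \<longlongrightarrow> 0) (at_right 0)"
  shows "((\<lambda>h. (support_fun (X h) u - support_fun (Y h) u) / h) \<longlongrightarrow> support_fun D u) (at_right (0::real))"
proof (rule LIM_zero_cancel, rule Lim_null_comparison)
  show "((\<lambda>h. norm u * hausdorff_dist ((*\<^sub>R) (inverse h) ` hukuhara_diff (X h) (Y h)) D) \<longlongrightarrow> 0) (at_right 0)"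
    using tendsto_mult_left[OF lim, of "norm u"] by simp
  show "\<forall>\<^sub>F h in at_right 0. norm ((support_fun (X h) u - support_fun (Y h) u) / h - support_fun D u)
      \<le> norm u * hausdorff_dist ((*\<^sub>R) (inverse h) ` hukuhara_diff (X h) (Y h)) D"
    using ev eventually_at_right_less[of 0]
  proof eventually_elim
    case (elim h)
    then obtain Z where Z: "is_hukuhara_diff (X h) (Y h) Z" by (auto simp: hukuhara_diff_exists_def)
    then have eq: "hukuhara_diff (X h) (Y h) = Z" using elim by (intro hukuhara_diff_eqI) auto
    have cb: "Z \<in> convex_bodies" "X h = Y h + Z" using Z by (auto simp: is_hukuhara_diff_def)
    have "(support_fun (X h) u - support_fun (Y h) u) / h = support_fun ((*\<^sub>R) (inverse h) ` Z) u"
      using elim cb by (simp add: support_fun_plus support_fun_scale divide_inverse)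
    then show ?case
      using support_fun_diff_le_hausdorff_dist[OF convex_bodies_scale[OF cb(1)] D] eq by simp
  qed
qed

lemma has_hukuhara_derivative_support_fun:
  assumes X: "\<And>s. 0 \<le> s \<Longrightarrow> X s \<in> convex_bodies" and t: "0 \<le> t"
    and der: "has_hukuhara_derivative X D t"
  shows "((\<lambda>s. support_fun (X s) u) has_real_derivative support_fun D u) (at t within {0..})"
proof -
  let ?q = "\<lambda>s. (support_fun (X s) u - support_fun (X t) u) / (s - t)"
  have D: "D \<in> convex_bodies" using der by (simp add: has_hukuhara_derivative_def)
  have "((\<lambda>h. (support_fun (X (t + h)) u - support_fun (X t) u) / h) \<longlongrightarrow> support_fun D u) (at_right 0)"
    using der X[OF t] by (intro hukuhara_quotient_tendsto D) (auto simp: has_hukuhara_derivative_def)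
  then have right: "(?q \<longlongrightarrow> support_fun D u) (at_right t)"
    by (simp add: filterlim_at_right_to_0[of _ _ t] add.commute)
  have "(?q \<longlongrightarrow> support_fun D u) (at t within {0..})"
  proof (cases "t = 0")
    case True
    then show ?thesis using right by (simp add: at_within_Ici_at_right)
  next
    case False
    then have "t > 0" using t by simp
    have "\<forall>\<^sub>F h in at_right 0. h < t" using eventually_at_right_real[OF \<open>t > 0\<close>] by eventually_elim simp
    then have "\<forall>\<^sub>F h in at_right 0. X (t - h) \<in> convex_bodies" by eventually_elim (simp add: X)
    then have "((\<lambda>h. (support_fun (X t) u - support_fun (X (t - h)) u) / h) \<longlongrightarrow> support_fun D u) (at_right 0)"
      using der \<open>t > 0\<close>
      by (intro hukuhara_quotient_tendsto D) (auto simp: has_hukuhara_derivative_def intro: eventually_conj)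
    moreover have "(support_fun (X t) u - support_fun (X (t - h)) u) / h = ?q (t - h)" for h
      by (simp add: divide_simps)
    ultimately have "(?q \<longlongrightarrow> support_fun D u) (at_left t)"
      by (simp add: filterlim_at_left_to_right[of _ _ t] filterlim_at_right_to_0[of _ _ "- t"])
    with right have "(?q \<longlongrightarrow> support_fun D u) (at t)" by (simp add: filterlim_split_at)
    then show ?thesis by (rule tendsto_within_subset) simp
  qed
  then show ?thesis by (simp add: has_field_derivative_iff)
qed

subsection \<open>The cyclic linear system\<close>

lemma sum_roots_of_unity:
  fixes j :: int
  assumes "m > 0"
  shows "(\<Sum>q<m. cis (2 * pi * real q * of_int j / real m)) = (if int m dvd j then of_nat m else 0)"
proof -
  define z where "z = cis (2 * pi * of_int j / real m)"
  have pow: "z ^ q = cis (2 * pi * real q * of_int j / real m)" for q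
    by (simp add: z_def Complex.DeMoivre mult_ac)
  have "z = 1 \<longleftrightarrow> int m dvd j"
  proof
    assume "z = 1"
    then have "cos (2 * pi * of_int j / real m) = 1" by (simp add: z_def complex_eq_iff)
    then obtain k :: int where "2 * pi * of_int j / real m = of_int k * 2 * pi"
      by (auto simp: cos_one_2pi_int)
    then have "of_int j = real_of_int (int m * k)" using \<open>m > 0\<close> by (simp add: field_simps)
    then have "j = int m * k" by linarith
    then show "int m dvd j" by simp
  next
    assume "int m dvd j"
    then obtain k where "j = int m * k" by blast
    then have "2 * pi * of_int j / real m = 2 * pi * of_int k" using \<open>m > 0\<close> by simp
    then show "z = 1" by (metis z_def Ints_of_int cis_multiple_2pi)
  qed
  moreover have "z ^ m = 1"
  proof -
    have "2 * pi * real m * of_int j / real m = 2 * pi * of_int j" using \<open>m > 0\<close> by simp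
    then show ?thesis by (metis pow Ints_of_int cis_multiple_2pi)
  qed
  moreover have "(\<Sum>q<m. z ^ q) = (if z = 1 then of_nat m else (z ^ m - 1) / (z - 1))"
    by (simp add: geometric_sum)
  ultimately show ?thesis by (simp add: pow)
qed

text \<open>The sum of \<open>t\<^sup>k / k!\<close> over \<open>k \<equiv> p (mod m)\<close>, written as a discrete Fourier transform of
  \<open>exp (t \<omega>\<^sup>q)\<close> with \<open>\<omega> = cis (2 \<pi> / m)\<close>.\<close>

definition cyclic_exp :: "nat \<Rightarrow> nat \<Rightarrow> real \<Rightarrow> real" where
  "cyclic_exp m p t = (\<Sum>q<m. exp (t * cos (2 * pi * real q / real m)) *
     cos (t * sin (2 * pi * real q / real m) - 2 * pi * real q * real p / real m)) / real m"

lemma cyclic_exp_deriv: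
  "(cyclic_exp m (Suc p) has_real_derivative cyclic_exp m p t) (at t within S)"
proof -
  define \<theta> where "\<theta> q = 2 * pi * real q / real m" for q
  have "((\<lambda>t. (\<Sum>q<m. exp (t * cos (\<theta> q)) * cos (t * sin (\<theta> q) - \<theta> q * real (Suc p))) / real m) has_real_derivative
    (\<Sum>q<m. exp (t * cos (\<theta> q)) * cos (t * sin (\<theta> q) - \<theta> q * real p)) / real m) (at t within S)"
  proof (intro DERIV_cdivide DERIV_sum)
    fix q
    have "t * sin (\<theta> q) - \<theta> q * real p = (t * sin (\<theta> q) - \<theta> q * real (Suc p)) + \<theta> q"
      by (simp add: algebra_simps)
    then have *: "cos (t * sin (\<theta> q) - \<theta> q * real p) =
        cos (t * sin (\<theta> q) - \<theta> q * real (Suc p)) * cos (\<theta> q) - sin (t * sin (\<theta> q) - \<theta> q * real (Suc p)) * sin (\<theta> q)"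
      by (simp only: cos_add)
    show "((\<lambda>t. exp (t * cos (\<theta> q)) * cos (t * sin (\<theta> q) - \<theta> q * real (Suc p))) has_real_derivative
        exp (t * cos (\<theta> q)) * cos (t * sin (\<theta> q) - \<theta> q * real p)) (at t within S)"
      unfolding * by (auto intro!: derivative_eq_intros simp: algebra_simps)
  qed
  then show ?thesis
    unfolding cyclic_exp_def[abs_def] \<theta>_def by (simp add: mult_ac)
qed

lemma cyclic_exp_periodic:
  assumes "m > 0"
  shows "cyclic_exp m (p + m) t = cyclic_exp m p t"
proof -
  have "cos (a - 2 * pi * real q * real (p + m) / real m) = cos (a - 2 * pi * real q * real p / real m)" for a q
  proof -
    have "a - 2 * pi * real q * real p / real m = (a - 2 * pi * real q * real (p + m) / real m) + 2 * pi * of_int (int q)"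
      using assms by (simp add: field_simps)
    moreover have "cos (b + 2 * pi * of_int (int q)) = cos b" for b
      by (simp only: cos_add sin_int_2pin cos_int_2pin mult_1_right mult_zero_right diff_zero)
    ultimately show ?thesis by metis
  qed
  then show ?thesis by (simp add: cyclic_exp_def)
qed

lemma cyclic_exp_0:
  assumes "p < m"
  shows "cyclic_exp m p 0 = (if p = 0 then 1 else 0)"
proof -
  have "cyclic_exp m p 0 = Re (\<Sum>q<m. cis (2 * pi * real q * of_int (int p) / real m)) / real m"
    by (simp add: cyclic_exp_def)
  also have "\<dots> = (if p = 0 then 1 else 0)"
    using assms by (subst sum_roots_of_unity) (auto dest: nat_dvd_not_less)
  finally show ?thesis .
qed

lemma cyclic_exp_sums:
  assumes "m > 0"
  shows "(\<lambda>k. if int m dvd int k - int p then t ^ k / fact k else 0) sums cyclic_exp m p t"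
    and "complex_of_real (cyclic_exp m p t) =
      (\<Sum>q<m. exp (of_real t * cis (2 * pi * real q / real m)) * cis (- (2 * pi * real q * real p / real m))) / of_nat m"
      (is "_ = ?C")
proof -
  define \<theta> where "\<theta> q = 2 * pi * real q / real m" for q
  define s where "s k = (if int m dvd int k - int p then t ^ k / fact k else 0)" for k
  have "(\<lambda>k. (\<Sum>q<m. ((of_real t * cis (\<theta> q)) ^ k /\<^sub>R fact k) * cis (- (\<theta> q * real p))) / of_nat m) sums
      ((\<Sum>q<m. exp (of_real t * cis (\<theta> q)) * cis (- (\<theta> q * real p))) / of_nat m)"
    by (intro sums_divide sums_sum sums_mult2 exp_converges)
  moreover have "(\<Sum>q<m. ((of_real t * cis (\<theta> q)) ^ k /\<^sub>R fact k) * cis (- (\<theta> q * real p))) / of_nat m = complex_of_real (s k)" for k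
  proof -
    have "((of_real t * cis (\<theta> q)) ^ k /\<^sub>R fact k) * cis (- (\<theta> q * real p)) =
        complex_of_real (t ^ k / fact k) * cis (2 * pi * real q * of_int (int k - int p) / real m)" for q
    proof -
      have "cis (\<theta> q) ^ k * cis (- (\<theta> q * real p)) = cis (2 * pi * real q * of_int (int k - int p) / real m)"
        unfolding Complex.DeMoivre cis_mult by (rule arg_cong[of _ _ cis]) (simp add: \<theta>_def diff_divide_distrib algebra_simps)
      then show ?thesis by (simp add: power_mult_distrib scaleR_conv_of_real divide_inverse mult_ac)
    qed
    then show ?thesis
      using sum_roots_of_unity[OF assms, of "int k - int p"] assms
      by (simp only: sum_distrib_left[symmetric]) (simp add: s_def)
  qed
  ultimately have sums: "(\<lambda>k. complex_of_real (s k)) sums ?C" by (simp add: \<theta>_def mult_ac)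
  have Re: "Re ?C = cyclic_exp m p t"
    by (simp add: cyclic_exp_def Re_exp Im_exp cos_diff algebra_simps)
  have "(\<lambda>k. 0) sums Im ?C" using sums_Im[OF sums] by (simp only: Im_complex_of_real)
  from sums_unique2[OF this sums_zero] show "complex_of_real (cyclic_exp m p t) = ?C"
    by (intro complex_eqI) (simp_all only: Re Re_complex_of_real Im_complex_of_real)
  show "(\<lambda>k. if int m dvd int k - int p then t ^ k / fact k else 0) sums cyclic_exp m p t"
    using sums_Re[OF sums] unfolding Re Re_complex_of_real s_def .
qed

lemma cyclic_exp_nonneg: "m > 0 \<Longrightarrow> 0 \<le> t \<Longrightarrow> 0 \<le> cyclic_exp m p t"
  by (rule sums_le[OF _ sums_zero cyclic_exp_sums(1)]) auto

lemma cyclic_exp_autocorrelation: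
  assumes "m > 0"
  shows "(\<Sum>p<m. cyclic_exp m p t * cyclic_exp m (p + r) t) =
    (\<Sum>q<m. exp (2 * t * cos (2 * pi * real q / real m)) * cos (2 * pi * real q * real r / real m)) / real m"
proof -
  define \<theta> where "\<theta> q = 2 * pi * real q / real m" for q
  define E where "E q = exp (of_real t * cis (\<theta> q))" for q
  have C: "complex_of_real (cyclic_exp m p t) = (\<Sum>q<m. E q * cis (- (\<theta> q * real p))) / of_nat m" for p
    using cyclic_exp_sums(2)[OF assms, of p t] by (simp add: E_def \<theta>_def mult_ac)
  have C': "complex_of_real (cyclic_exp m p t) = (\<Sum>q<m. cnj (E q) * cis (\<theta> q * real p)) / of_nat m" for p
    using arg_cong[OF C[of p], of cnj] by (simp add: cis_cnj)
  have orth: "(\<Sum>p<m. (cnj (E q) * cis (\<theta> q * real p)) * (E q' * cis (- (\<theta> q' * real (p + r))))) =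
      (if q' = q then of_nat m * (cnj (E q) * E q * cis (- (\<theta> q * real r))) else 0)"
    if "q < m" "q' < m" for q q'
  proof -
    have "(\<Sum>p<m. (cnj (E q) * cis (\<theta> q * real p)) * (E q' * cis (- (\<theta> q' * real (p + r))))) =
      cnj (E q) * E q' * cis (- (\<theta> q' * real r)) * (\<Sum>p<m. cis (2 * pi * real p * of_int (int q - int q') / real m))"
      unfolding sum_distrib_left
    proof (intro sum.cong refl)
      fix p
      have "cis (\<theta> q * real p) * cis (- (\<theta> q' * real (p + r))) =
        cis (- (\<theta> q' * real r)) * cis (2 * pi * real p * of_int (int q - int q') / real m)"
        unfolding cis_mult by (rule arg_cong[of _ _ cis]) (simp add: \<theta>_def diff_divide_distrib add_divide_distrib algebra_simps)
      then show "(cnj (E q) * cis (\<theta> q * real p)) * (E q' * cis (- (\<theta> q' * real (p + r)))) =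
        cnj (E q) * E q' * cis (- (\<theta> q' * real r)) * cis (2 * pi * real p * of_int (int q - int q') / real m)"
        by (simp add: mult_ac)
    qed
    moreover have "int m dvd int q - int q' \<longleftrightarrow> q' = q"
      using that by (auto simp: mod_eq_dvd_iff[symmetric])
    ultimately show ?thesis unfolding sum_roots_of_unity[OF assms] by simp
  qed
  have EE: "cnj (E q) * E q = of_real (exp (2 * t * cos (\<theta> q)))" for q
  proof -
    have "cnj (E q) * E q = exp (of_real t * (cnj (cis (\<theta> q)) + cis (\<theta> q)))"
      by (simp add: E_def exp_cnj exp_add distrib_left)
    also have "cnj (cis (\<theta> q)) + cis (\<theta> q) = of_real (2 * cos (\<theta> q))"
      by (simp add: complex_eq_iff)
    finally show ?thesis by (simp add: exp_of_real[symmetric] mult_ac)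
  qed
  define g where "g p q q' = (cnj (E q) * cis (\<theta> q * real p)) * (E q' * cis (- (\<theta> q' * real (p + r))))" for p q q'
  have "complex_of_real (cyclic_exp m p t * cyclic_exp m (p + r) t) =
      (\<Sum>q<m. \<Sum>q'<m. g p q q') / (of_nat m)\<^sup>2" for p
    unfolding of_real_mult C'[of p] C[of "p + r"] g_def
    by (simp only: sum_product times_divide_times_eq power2_eq_square)
  then have "complex_of_real (\<Sum>p<m. cyclic_exp m p t * cyclic_exp m (p + r) t) =
      (\<Sum>p<m. \<Sum>q<m. \<Sum>q'<m. g p q q') / (of_nat m)\<^sup>2"
    by (simp only: of_real_sum sum_divide_distrib[symmetric])
  also have "(\<Sum>p<m. \<Sum>q<m. \<Sum>q'<m. g p q q') = (\<Sum>q<m. \<Sum>p<m. \<Sum>q'<m. g p q q')"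
    by (rule sum.swap)
  also have "\<dots> = (\<Sum>q<m. \<Sum>q'<m. \<Sum>p<m. g p q q')"
    by (rule sum.cong[OF refl sum.swap])
  also have "\<dots> = (\<Sum>q<m. \<Sum>q'<m. if q' = q then of_nat m * (cnj (E q) * E q * cis (- (\<theta> q * real r))) else 0)"
    unfolding g_def by (intro sum.cong refl orth) auto
  also have "\<dots> = of_nat m * (\<Sum>q<m. cnj (E q) * E q * cis (- (\<theta> q * real r)))"
    by (simp add: sum.delta sum_distrib_left)
  also have "\<dots> = of_nat m * (\<Sum>q<m. of_real (exp (2 * t * cos (\<theta> q))) * cis (- (\<theta> q * real r)))"
    by (simp only: EE)
  finally have "complex_of_real (\<Sum>p<m. cyclic_exp m p t * cyclic_exp m (p + r) t) =
      (\<Sum>q<m. of_real (exp (2 * t * cos (\<theta> q))) * cis (- (\<theta> q * real r))) / of_nat m"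
    using assms by (simp add: power2_eq_square)
  from arg_cong[OF this, of Re] show ?thesis
    by (simp add: \<theta>_def mult_ac)
qed

lemma linear_funpow: "linear f \<Longrightarrow> linear (f ^^ n)"
  for f :: "'a::real_vector \<Rightarrow> 'a"
  by (induction n) (simp_all add: linear_id linear_compose)

theorem hukuhara_solution_eq:
  fixes A :: "'a::euclidean_space \<Rightarrow> 'a"
  assumes A: "linear A" "m > 0" "A ^^ m = id"
    and X: "is_hukuhara_solution A X0 X" and t: "0 \<le> t"
  shows "X t = (\<Sum>p<m. (*\<^sub>R) (cyclic_exp m p t) ` (A ^^ p) ` X0)"
proof (rule support_fun_inject)
  have cb: "X s \<in> convex_bodies" and der: "has_hukuhara_derivative X (A ` X s) s" if "0 \<le> s" for s
    using X that by (auto simp: is_hukuhara_solution_def)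
  have X0: "X 0 = X0" using X by (simp add: is_hukuhara_solution_def)
  have lin: "linear (A ^^ p)" for p using A by (simp add: linear_funpow)
  have cbp: "(A ^^ p) ` X s \<in> convex_bodies" if "0 \<le> s" for p s
    using lin cb[OF that] by (rule convex_bodies_linear_image)
  show "X t \<in> convex_bodies" using cb t .
  show "(\<Sum>p<m. (*\<^sub>R) (cyclic_exp m p t) ` (A ^^ p) ` X0) \<in> convex_bodies"
    using cbp[of 0] by (intro convex_bodies_sum convex_bodies_scale) (simp add: X0)
  fix u
  define Y where "Y p s = support_fun ((A ^^ p) ` X s) u" for p s
  have Y_deriv: "(Y p has_real_derivative Y (Suc p) s) (at s within {0..t})" if s: "s \<in> {0..t}" for p s
  proof (rule has_field_derivative_transform_within[OF _ zero_less_one s])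
    have "0 \<le> s" using s by simp
    have "support_fun (A ` X s) (adjoint (A ^^ p) u) = Y (Suc p) s"
      unfolding Y_def support_fun_linear_image[OF lin convex_bodies_linear_image[OF A(1) cb[OF \<open>0 \<le> s\<close>]], symmetric]
      by (simp add: image_comp funpow_Suc_right del: funpow.simps)
    then show "((\<lambda>s. support_fun (X s) (adjoint (A ^^ p) u)) has_real_derivative Y (Suc p) s) (at s within {0..t})"
      using DERIV_subset[OF has_hukuhara_derivative_support_fun[OF cb \<open>0 \<le> s\<close> der[OF \<open>0 \<le> s\<close>]],
          of "{0..t}" "adjoint (A ^^ p) u"] by auto
    fix r assume "r \<in> {0..t}"
    then show "support_fun (X r) (adjoint (A ^^ p) u) = Y p r"
      by (simp add: Y_def support_fun_linear_image[OF lin cb])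
  qed
  have Y_per: "Y (p + m) s = Y p s" for p s
    by (simp add: Y_def funpow_add A(3))
  \<comment> \<open>Variation of constants: \<open>W\<close> does not depend on \<open>s\<close>; compare \<open>s = 0\<close> and \<open>s = t\<close>.\<close>
  define W where "W s = (\<Sum>p<m. cyclic_exp m p (t - s) * Y p s)" for s
  have "(W has_real_derivative 0) (at s within {0..t})" if s: "s \<in> {0..t}" for s
  proof -
    define f where "f p = cyclic_exp m (p + m - 1) (t - s) * Y p s" for p
    have c: "((\<lambda>s. cyclic_exp m p (t - s)) has_real_derivative - cyclic_exp m (p + m - 1) (t - s)) (at s within {0..t})" for p
    proof -
      have "(cyclic_exp m p has_real_derivative cyclic_exp m (p + m - 1) (t - s)) (at (t - s))"
      proof -
        have "cyclic_exp m (p + m) = cyclic_exp m p" by (rule ext) (rule cyclic_exp_periodic[OF A(2)])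
        then show ?thesis using cyclic_exp_deriv[of m "p + m - 1" "t - s" UNIV] A(2) by simp
      qed
      then show ?thesis
        by (rule DERIV_chain2[THEN DERIV_cong]) (auto intro!: derivative_eq_intros)
    qed
    have "(W has_real_derivative (\<Sum>p<m. cyclic_exp m p (t - s) * Y (Suc p) s + - cyclic_exp m (p + m - 1) (t - s) * Y p s)) (at s within {0..t})"
      unfolding W_def using s by (intro DERIV_sum DERIV_mult' c Y_deriv) auto
    moreover have "cyclic_exp m p (t - s) * Y (Suc p) s + - cyclic_exp m (p + m - 1) (t - s) * Y p s = f (Suc p) - f p" for p
      by (simp add: f_def cyclic_exp_periodic[OF A(2)])
    moreover have "f m = f 0"
      using cyclic_exp_periodic[OF A(2), of "m - 1"] Y_per[of 0] A(2) by (simp add: f_def)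
    ultimately show ?thesis by (simp add: sum_lessThan_telescope)
  qed
  then have "\<exists>c. \<forall>s\<in>{0..t}. W s = c"
    by (intro has_field_derivative_zero_constant) auto
  then have "W t = W 0" using t by fastforce
  moreover have "W t = Y 0 t"
  proof -
    have "W t = (\<Sum>p<m. if p = 0 then Y p t else 0)"
      unfolding W_def by (intro sum.cong refl) (simp add: cyclic_exp_0)
    then show ?thesis using A(2) by simp
  qed
  ultimately have "support_fun (X t) u = (\<Sum>p<m. cyclic_exp m p t * support_fun ((A ^^ p) ` X0) u)"
    by (simp add: Y_def W_def X0)
  also have "\<dots> = support_fun (\<Sum>p<m. (*\<^sub>R) (cyclic_exp m p t) ` (A ^^ p) ` X0) u"
    using cbp[of 0] cyclic_exp_nonneg[OF A(2) t]
    by (subst support_fun_sum) (simp_all add: support_fun_scale convex_bodies_scale X0)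
  finally show "support_fun (X t) u = support_fun (\<Sum>p<m. (*\<^sub>R) (cyclic_exp m p t) ` (A ^^ p) ` X0) u" .
qed

subsection \<open>Mixed area of solutions\<close>

lemma sum_periodic_shift:
  fixes g :: "nat \<Rightarrow> 'a::cancel_comm_monoid_add"
  assumes "\<And>r. g (r + m) = g r"
  shows "(\<Sum>q<m. g (q + k)) = (\<Sum>q<m. g q)"
proof (induction k)
  case (Suc k)
  have "g k + (\<Sum>q<m. g (Suc q + k)) = (\<Sum>q<m. g (q + k)) + g (m + k)"
    using sum.lessThan_Suc_shift[of "\<lambda>q. g (q + k)" m] sum.lessThan_Suc[of "\<lambda>q. g (q + k)" m] by simp
  also have "g (m + k) = g k" using assms[of k] by (simp add: add.commute)
  finally show ?case using Suc by (simp add: add.commute)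
qed simp

lemma orthogonal_transformation_funpow:
  "orthogonal_transformation f \<Longrightarrow> orthogonal_transformation (f ^^ n)"
  for f :: "'a::real_inner \<Rightarrow> 'a"
  by (induction n) (simp_all add: orthogonal_transformation_def linear_compose linear_id)

lemma solid_convex_bodies_orthogonal_image:
  fixes f :: "'a::euclidean_space \<Rightarrow> 'a"
  assumes "orthogonal_transformation f" "K \<in> solid_convex_bodies"
  shows "f ` K \<in> solid_convex_bodies"
proof -
  have "linear f" "inj f"
    using assms(1) by (auto simp: orthogonal_transformation_linear orthogonal_transformation_inj)
  then show ?thesis
    using assms(2)
    by (simp add: solid_convex_bodies_def convex_bodies_linear_image interior_injective_linear_image)
qed

lemma mixed_area_orthogonal_image:
  assumes "orthogonal_transformation f" "X \<in> convex_bodies" "Y \<in> convex_bodies"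
  shows "mixed_area (f ` X) (f ` Y) = mixed_area X Y"
proof -
  have "f (x + y) = f x + f y" for x y
    using assms(1) by (simp add: linear_add orthogonal_transformation_linear)
  then have "f ` X + f ` Y = f ` (X + Y)"
    by (auto simp: set_plus_def image_iff) metis+
  moreover have "measure lebesgue (f ` Z) = measure lebesgue Z" if "Z \<in> convex_bodies" for Z
    using that assms(1) by (intro measure_orthogonal_image) (auto simp: convex_bodies_def lmeasurable_compact)
  ultimately show ?thesis
    using assms by (simp add: mixed_area_def convex_bodies_plus)
qed

theorem mixed_area_hukuhara_solutions:
  assumes A: "orthogonal_transformation A" "m > 0" "A ^^ m = id"
    and X0: "X0 \<in> solid_convex_bodies" "X0' \<in> solid_convex_bodies"
    and X: "is_hukuhara_solution A X0 X" "is_hukuhara_solution A X0' X'"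
    and t: "t \<ge> 0"
  shows "mixed_area (X t) (X' t) = (\<Sum>r<m. (\<Sum>q<m. exp (2 * t * cos (2 * pi * real q / real m)) *
    cos (2 * pi * real q * real r / real m)) / real m * mixed_area X0 ((A ^^ r) ` X0'))"
proof -
  define c where "c p = cyclic_exp m p t" for p
  define \<sigma> where "\<sigma> r = mixed_area X0 ((A ^^ r) ` X0')" for r
  have orth: "orthogonal_transformation (A ^^ p)" for p
    using A(1) by (rule orthogonal_transformation_funpow)
  have solid: "(A ^^ p) ` X0 \<in> solid_convex_bodies" "(A ^^ p) ` X0' \<in> solid_convex_bodies" for p
    using solid_convex_bodies_orthogonal_image[OF orth] X0 by auto
  then have cb: "(A ^^ p) ` X0 \<in> convex_bodies" "(A ^^ p) ` X0' \<in> convex_bodies" for p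
    by (auto simp: solid_convex_bodies_def)
  have c_per: "c (p + m) = c p" for p by (simp add: c_def cyclic_exp_periodic[OF A(2)])
  have \<sigma>_per: "\<sigma> (p + m) = \<sigma> p" for p by (simp add: \<sigma>_def funpow_add A(3))
  have shift: "mixed_area ((A ^^ p) ` X0) ((A ^^ q) ` X0') = \<sigma> (q + (m - p))" if "p < m" for p q
  proof -
    have "mixed_area ((A ^^ p) ` X0) ((A ^^ q) ` X0') =
        mixed_area ((A ^^ (m - p)) ` (A ^^ p) ` X0) ((A ^^ (m - p)) ` (A ^^ q) ` X0')"
      by (rule mixed_area_orthogonal_image[OF orth cb, symmetric])
    also have "(A ^^ (m - p)) ` (A ^^ p) ` X0 = X0"
      using that A(3) by (simp only: image_comp funpow_add[symmetric]) simp
    also have "(A ^^ (m - p)) ` (A ^^ q) ` X0' = (A ^^ (q + (m - p))) ` X0'"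
      by (simp only: image_comp funpow_add[symmetric] add.commute)
    finally show ?thesis by (simp add: \<sigma>_def)
  qed
  have lin: "linear A" using A(1) by (rule orthogonal_transformation_linear)
  have "mixed_area (X t) (X' t) =
      (\<Sum>p<m. \<Sum>q<m. c p * c q * mixed_area ((A ^^ p) ` X0) ((A ^^ q) ` X0'))"
    unfolding hukuhara_solution_eq[OF lin A(2,3) X(1) t] hukuhara_solution_eq[OF lin A(2,3) X(2) t] c_def
    by (intro mixed_area_sum_sum solid cyclic_exp_nonneg[OF A(2) t]) auto
  also have "\<dots> = (\<Sum>p<m. \<Sum>r<m. c p * c (p + r) * \<sigma> r)"
  proof (rule sum.cong[OF refl])
    fix p assume "p \<in> {..<m}"
    then have p: "p < m" by simp
    have "c (p + (q + (m - p))) = c q" for q using c_per[of q] p by (simp add: add.commute add.left_commute)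
    then have "(\<Sum>q<m. c p * c q * mixed_area ((A ^^ p) ` X0) ((A ^^ q) ` X0')) =
        (\<Sum>q<m. (\<lambda>r. c p * c (p + r) * \<sigma> r) (q + (m - p)))"
      using shift[OF p] by simp
    also have "\<dots> = (\<Sum>r<m. c p * c (p + r) * \<sigma> r)"
      by (rule sum_periodic_shift) (simp add: \<sigma>_per c_per flip: add.assoc)
    finally show "(\<Sum>q<m. c p * c q * mixed_area ((A ^^ p) ` X0) ((A ^^ q) ` X0')) =
        (\<Sum>r<m. c p * c (p + r) * \<sigma> r)" .
  qed
  also have "\<dots> = (\<Sum>r<m. (\<Sum>p<m. c p * c (p + r)) * \<sigma> r)"
    by (subst sum.swap) (simp add: sum_distrib_right)
  finally show ?thesis
    unfolding c_def \<sigma>_def cyclic_exp_autocorrelation[OF A(2)] .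
qed

lemma trig_reflect:
  assumes "q \<le> m" "m > 0"
  shows "cos (2 * pi * real p * real (m - q) / real m) = cos (2 * pi * real p * real q / real m)"
    and "sin (2 * pi * real p * real (m - q) / real m) = - sin (2 * pi * real p * real q / real m)"
proof -
  have eq: "2 * pi * real p * real (m - q) / real m = 2 * pi * of_int (int p) - 2 * pi * real p * real q / real m"
    using assms by (simp add: of_nat_diff field_simps)
  show "cos (2 * pi * real p * real (m - q) / real m) = cos (2 * pi * real p * real q / real m)"
    unfolding eq cos_diff sin_int_2pin cos_int_2pin by simp
  show "sin (2 * pi * real p * real (m - q) / real m) = - sin (2 * pi * real p * real q / real m)"
    unfolding eq sin_diff sin_int_2pin cos_int_2pin by simp
qed

lemma sum_reflect_halves:
  fixes f :: "nat \<Rightarrow> 'a::comm_semiring_1"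
  assumes f: "\<And>q. q \<in> {1..h} \<Longrightarrow> f (m - q) = f q" and h: "2 * h < m"
  shows "(\<Sum>q<m. f q) = f 0 + (\<Sum>q\<in>{h<..<m - h}. f q) + 2 * (\<Sum>q=1..h. f q)"
proof -
  have "{..<m} = insert 0 ({1..h} \<union> ({h<..<m - h} \<union> {m - h..<m}))"
    using h by auto
  also have "sum f \<dots> = f 0 + (sum f {1..h} + (sum f {h<..<m - h} + sum f {m - h..<m}))"
    using h by (subst sum.insert sum.union_disjoint; auto)+
  also have "sum f {m - h..<m} = (\<Sum>q=1..h. f (m - q))"
    using h by (intro sum.reindex_bij_witness[of _ "\<lambda>q. m - q" "\<lambda>q. m - q"]) auto
  also have "\<dots> = sum f {1..h}" by (intro sum.cong refl f)
  finally show ?thesis by (simp add: mult_2 ac_simps)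
qed

theorem mixed_area_hukuhara_solutions_symmetric:
  assumes A: "orthogonal_transformation A" "m > 0" "A ^^ m = id"
    and X0: "X0 \<in> solid_convex_bodies" "X0' \<in> solid_convex_bodies"
    and X: "is_hukuhara_solution A X0 X" "is_hukuhara_solution A X0' X'"
    and t: "t \<ge> 0"
  shows "mixed_area (X t) (X' t) =
    1 / real m * (\<Sum>q<m. exp (2 * t * cos (2 * pi * real q / real m))) * mixed_area X0 X0' +
    1 / (real m)\<^sup>2 * (\<Sum>p=1..m - 1.
      (\<Sum>q<m. ((real m - real p) * cos (2 * pi * real p * real q / real m)
          + 2 * t * sin (2 * pi * real p * real q / real m) * sin (2 * pi * real q / real m))
        * exp (2 * t * cos (2 * pi * real q / real m))) *
      (mixed_area X0 ((A ^^ p) ` X0') + mixed_area X0' ((A ^^ p) ` X0)))"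
proof -
  define e where "e q = exp (2 * t * cos (2 * pi * real q / real m))" for q
  define D where "D p = (\<Sum>q<m. cos (2 * pi * real p * real q / real m) * e q)" for p
  define w where "w p = (\<Sum>q<m. ((real m - real p) * cos (2 * pi * real p * real q / real m)
      + 2 * t * sin (2 * pi * real p * real q / real m) * sin (2 * pi * real q / real m)) * e q)" for p
  define \<sigma> where "\<sigma> r = mixed_area X0 ((A ^^ r) ` X0')" for r
  have \<sigma>': "mixed_area X0' ((A ^^ p) ` X0) = \<sigma> (m - p)" if "p \<le> m" for p
  proof -
    have orth: "orthogonal_transformation (A ^^ n)" for n
      using A(1) by (rule orthogonal_transformation_funpow)
    have "(A ^^ p) ` X0 \<in> convex_bodies" "X0' \<in> convex_bodies"
      using solid_convex_bodies_orthogonal_image[OF orth X0(1)] X0 by (auto simp: solid_convex_bodies_def)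
    then have "mixed_area X0' ((A ^^ p) ` X0) = mixed_area ((A ^^ (m - p)) ` X0') ((A ^^ (m - p)) ` (A ^^ p) ` X0)"
      by (intro mixed_area_orthogonal_image[OF orth, symmetric])
    also have "(A ^^ (m - p)) ` (A ^^ p) ` X0 = X0"
      using that A(3) by (simp only: image_comp funpow_add[symmetric]) simp
    finally show ?thesis by (simp add: \<sigma>_def mixed_area_commute)
  qed
  \<comment> \<open>The terms with the factor \<open>t\<close> are odd under \<open>p \<mapsto> m - p\<close>, while the mixed areas are symmetric.\<close>
  have w: "w p + w (m - p) = real m * D p" if "p \<le> m" for p
    unfolding w_def D_def sum_distrib_left sum.distrib[symmetric]
  proof (rule sum.cong[OF refl])
    fix q
    have *: "cos (2 * pi * real (m - p) * real q / real m) = cos (2 * pi * real p * real q / real m)"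
      "sin (2 * pi * real (m - p) * real q / real m) = - sin (2 * pi * real p * real q / real m)"
      using trig_reflect[OF that A(2), of q] by (simp_all add: mult_ac)
    show "((real m - real p) * cos (2 * pi * real p * real q / real m)
        + 2 * t * sin (2 * pi * real p * real q / real m) * sin (2 * pi * real q / real m)) * e q +
      ((real m - real (m - p)) * cos (2 * pi * real (m - p) * real q / real m)
        + 2 * t * sin (2 * pi * real (m - p) * real q / real m) * sin (2 * pi * real q / real m)) * e q =
      real m * (cos (2 * pi * real p * real q / real m) * e q)"
      unfolding * using that by (simp add: of_nat_diff algebra_simps)
  qed
  have "(\<Sum>p=1..m - 1. w p * \<sigma> (m - p)) = (\<Sum>p=1..m - 1. w (m - p) * \<sigma> p)"
    by (rule sum.reindex_bij_witness[of _ "\<lambda>p. m - p" "\<lambda>p. m - p"]) auto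
  then have "(\<Sum>p=1..m - 1. w p * (\<sigma> p + \<sigma> (m - p))) = (\<Sum>p=1..m - 1. (w p + w (m - p)) * \<sigma> p)"
    by (simp add: distrib_left distrib_right sum.distrib)
  also have "\<dots> = (\<Sum>p=1..m - 1. real m * D p * \<sigma> p)"
    by (intro sum.cong refl) (use w in auto)
  finally have sum_w: "(\<Sum>p=1..m - 1. w p * (\<sigma> p + \<sigma> (m - p))) = real m * (\<Sum>p=1..m - 1. D p * \<sigma> p)"
    by (simp add: sum_distrib_left mult.assoc)
  have "mixed_area (X t) (X' t) = (\<Sum>r<m. D r / real m * \<sigma> r)"
    unfolding mixed_area_hukuhara_solutions[OF assms] by (simp add: D_def \<sigma>_def e_def mult_ac)
  also have "{..<m} = insert 0 {1..m - 1}" using A(2) by auto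
  also have "(\<Sum>r\<in>insert 0 {1..m - 1}. D r / real m * \<sigma> r) =
      1 / real m * D 0 * \<sigma> 0 + 1 / (real m)\<^sup>2 * (real m * (\<Sum>p=1..m - 1. D p * \<sigma> p))"
    using A(2) by (simp add: sum_divide_distrib power2_eq_square)
  also have "real m * (\<Sum>p=1..m - 1. D p * \<sigma> p) =
      (\<Sum>p=1..m - 1. w p * (\<sigma> p + mixed_area X0' ((A ^^ p) ` X0)))"
    unfolding sum_w[symmetric] by (intro sum.cong refl) (auto simp: \<sigma>')
  finally show ?thesis by (simp add: D_def w_def \<sigma>_def e_def)
qed

theorem lemma3p4:
  fixes A :: "real^2 \<Rightarrow> real^2"
    and m :: nat
    and X0 X0' :: "(real^2) set"
    and X X' :: "real \<Rightarrow> (real^2) set"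
    and t :: real
  assumes "orthogonal_transformation A"
    and "m > 0"
    and "A ^^ m = id"
    and "X0 \<in> solid_convex_bodies"
    and "X0' \<in> solid_convex_bodies"
    and "is_hukuhara_solution A X0 X"
    and "is_hukuhara_solution A X0' X'"
    and "t \<ge> 0"
  shows
    "(m \<ge> 3 \<and> odd m \<longrightarrow>
       mixed_area (X t) (X' t) =
         (1 / real m) *
           (exp (2 * t) + 2 * (\<Sum>q=1..m div 2. exp (2 * t * cos (2 * pi * real q / real m))))
           * mixed_area X0 X0'
         + (1 / (real m)\<^sup>2) *
           (\<Sum>p=1..m-1.
              ((real m - real p) * exp (2 * t)
               + 2 * (\<Sum>q=1..m div 2.
                   ((real m - real p) * cos (2 * pi * real p * real q / real m)
                    + 2 * t * sin (2 * pi * real p * real q / real m)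
                        * sin (2 * pi * real q / real m))
                   * exp (2 * t * cos (2 * pi * real q / real m))))
              * (mixed_area X0 ((A ^^ p) ` X0') + mixed_area X0' ((A ^^ p) ` X0))))
     \<and>
     (m \<ge> 4 \<and> even m \<longrightarrow>
       mixed_area (X t) (X' t) =
         (1 / real m) *
           (exp (2 * t) + exp (- 2 * t)
            + 2 * (\<Sum>q=1..(m - 2) div 2. exp (2 * t * cos (2 * pi * real q / real m))))
           * mixed_area X0 X0'
         + (1 / (real m)\<^sup>2) *
           (\<Sum>p=1..m-1.
              ((real m - real p) * (exp (2 * t) + (-1) ^ p * exp (- 2 * t))
               + 2 * (\<Sum>q=1..(m - 2) div 2.
                   ((real m - real p) * cos (2 * pi * real p * real q / real m)
                    + 2 * t * sin (2 * pi * real p * real q / real m)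
                        * sin (2 * pi * real q / real m))
                   * exp (2 * t * cos (2 * pi * real q / real m))))
              * (mixed_area X0 ((A ^^ p) ` X0') + mixed_area X0' ((A ^^ p) ` X0))))"
proof -
  define f where "f p q = ((real m - real p) * cos (2 * pi * real p * real q / real m)
      + 2 * t * sin (2 * pi * real p * real q / real m) * sin (2 * pi * real q / real m))
    * exp (2 * t * cos (2 * pi * real q / real m))" for p q
  define e where "e q = exp (2 * t * cos (2 * pi * real q / real m))" for q
  have e_reflect: "e (m - q) = e q" and f_reflect: "f p (m - q) = f p q" if "q \<le> m" for p q
    using trig_reflect[OF that \<open>m > 0\<close>, of p] trig_reflect[OF that \<open>m > 0\<close>, of 1]
    by (simp_all add: e_def f_def)
  have e0: "e 0 = exp (2 * t)" and f0: "f p 0 = (real m - real p) * exp (2 * t)" for p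
    by (simp_all add: e_def f_def)
  have main: "mixed_area (X t) (X' t) =
      1 / real m * (\<Sum>q<m. e q) * mixed_area X0 X0' +
      1 / (real m)\<^sup>2 * (\<Sum>p=1..m - 1. (\<Sum>q<m. f p q) *
        (mixed_area X0 ((A ^^ p) ` X0') + mixed_area X0' ((A ^^ p) ` X0)))"
    using mixed_area_hukuhara_solutions_symmetric[OF assms] by (simp only: e_def f_def)
  show ?thesis
  proof (intro conjI impI, goal_cases)
    case 1
    then have h: "2 * (m div 2) < m" and mid: "{m div 2<..<m - m div 2} = {}" by presburger auto
    have "(\<Sum>q<m. e q) = exp (2 * t) + 2 * (\<Sum>q=1..m div 2. e q)"
      by (subst sum_reflect_halves[of "m div 2" e m]) (use h in \<open>auto simp: mid e0 e_reflect\<close>)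
    moreover have "(\<Sum>q<m. f p q) = (real m - real p) * exp (2 * t) + 2 * (\<Sum>q=1..m div 2. f p q)" for p
      by (subst sum_reflect_halves[of "m div 2" "f p" m]) (use h in \<open>auto simp: mid f0 f_reflect\<close>)
    ultimately show ?case
      using main by (simp only: e_def f_def)
  next
    case m: 2
    let ?h = "(m - 2) div 2"
    obtain k where k: "m = 2 * k" using m by blast
    have h: "2 * ?h < m" and mid: "{?h<..<m - ?h} = {k}" using m k by auto
    have "2 * pi * real k / real m = pi" using m k by simp
    moreover have "2 * pi * real p * real k / real m = real p * pi" for p using m k by simp
    ultimately have ek: "e k = exp (- 2 * t)"
      and fk: "f p k = (real m - real p) * ((-1) ^ p * exp (- 2 * t))" for p
      by (simp_all only: e_def f_def) simp_all
    have "(\<Sum>q<m. e q) = exp (2 * t) + exp (- 2 * t) + 2 * (\<Sum>q=1..?h. e q)"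
      by (subst sum_reflect_halves[of ?h e m]) (use h in \<open>simp_all add: mid e0 ek e_reflect\<close>)
    moreover have "(\<Sum>q<m. f p q) = (real m - real p) * (exp (2 * t) + (-1) ^ p * exp (- 2 * t)) + 2 * (\<Sum>q=1..?h. f p q)" for p
      by (subst sum_reflect_halves[of ?h "f p" m]) (use h in \<open>simp_all add: mid f0 fk f_reflect distrib_left\<close>)
    ultimately show ?case
      using main by (simp only: e_def f_def)
  qed
qed

end
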